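(* Let $G$ be a countable discrete group, $\nu:G\to U(\mathcal{H})$ a unitary representation on a Hilbert space $\mathcal{H}$, $\mathcal{A}$ the group $*$-algebra of $G$, and $\Lambda\subset\mathcal{H}$ a linear subspace that is invariant under $\mathcal{A}$ and such that for all $\zeta,\eta\in\Lambda$ one has $\langle\zeta,\nu_g\eta\rangle=0$ for all but finitely many $g\in G$. Equip $\Lambda$ with the $\mathcal{A}$-valued form $\langle\cdot,\cdot\rangle_{\mathcal{A}}$. Let $E\subset\Lambda$ be an $\mathcal{A}$-submodule and let $\zeta_1,\dots,\zeta_d,\tilde\zeta_1,\dots,\tilde\zeta_d\in E$. The following conditions are equivalent: (1) the families $\{\zeta_i\}_{1\le i\le d}$ and $\{\tilde\zeta_i\}_{1\le i\le d}$ form dual $G$-frames for $\overline{E}$, the closure of $E$ in $\mathcal{H}$; (2) the families $\{\zeta_i\}_{1\le i\le d}$ and $\{\tilde\zeta_i\}_{1\le i\le d}$ form dual module frames for $E$.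
   Context: Inner products are linear in the first variable. Let $\lambda$ be the left regular representation of $G$ on $l^2(G)$, $(\lambda_g a)_{h}=a_{g^{-1}h}$. $\mathcal{A}$ is the $*$-algebra of finite complex linear combinations of the operators $\lambda_g$, $g\in G$. It acts on $\mathcal{H}$ by the $*$-homomorphism $\pi_0:\mathcal{A}\to B(\mathcal{H})$ with $\pi_0(\lambda_g)=\nu_g$; invariance of $\Lambda$ means $\pi_0(a)\Lambda\subset\Lambda$ for all $a\in\mathcal{A}$, and $\Lambda$ is a left $\mathcal{A}$-module by $a\zeta=\pi_0(a)\zeta$. The form on $\Lambda$ is $\langle\zeta,\eta\rangle_{\mathcal{A}}=\sum_{g\in G}\langle\zeta,\nu_g\eta\rangle\lambda_g\in\mathcal{A}$ (a finite sum). Dual module frames for $E$: $\langle\zeta,\eta\rangle_{\mathcal{A}}=\sum_{i=1}^d\langle\zeta,\zeta_i\rangle_{\mathcal{A}}\langle\tilde\zeta_i,\eta\rangle_{\mathcal{A}}$ for all $\zeta,\eta\in E$. A countable family $\{\xi_i\}_{i\in I}$ of vectors in a Hilbert space $\mathcal{K}$ is a frame for $\mathcal{K}$ if there are $A,B>0$ with $A\|\zeta\|^2\le\sum_{i}|\langle\zeta,\xi_i\rangle|^2\le B\|\zeta\|^2$ for all $\zeta\in\mathcal{K}$. Two frames $\{\xi_i\}_{i\in I},\{\tilde\xi_i\}_{i\in I}$ for $\mathcal{K}$ are dual if $\zeta=\sum_i\langle\zeta,\xi_i\rangle\tilde\xi_i=\sum_i\langle\zeta,\tilde\xi_i\rangle\xi_i$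 for all $\zeta\in\mathcal{K}$. Families $\{\zeta_i\}_{1\le i\le d}$ and $\{\tilde\zeta_i\}_{1\le i\le d}$ form dual $G$-frames for $\overline{E}$ if $\{\nu_g\zeta_i\}_{g\in G,1\le i\le d}$ and $\{\nu_g\tilde\zeta_i\}_{g\in G,1\le i\le d}$ (indexed by pairs $(g,i)$) are dual frames for $\overline{E}$. *)

theory Defs
  imports "HOL-Analysis.Analysis" "HOL-Algebra.Group"
begin

text \<open>The inner product is linear in the first variable. Completeness comes from the class
  \<^class>\<open>banach\<close>; a Hilbert space is the universe of a type of the class below.\<close>

class complex_hilbert_space = banach +
  fixes scaleC :: "complex \<Rightarrow> 'a \<Rightarrow> 'a"  (infixr "*\<^sub>C" 75)
    and cinner :: "'a \<Rightarrow> 'a \<Rightarrow> complex"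
  assumes scaleC_add_right: "c *\<^sub>C (x + y) = c *\<^sub>C x + c *\<^sub>C y"
    and scaleC_add_left: "(b + c) *\<^sub>C x = b *\<^sub>C x + c *\<^sub>C x"
    and scaleC_scaleC: "b *\<^sub>C c *\<^sub>C x = (b * c) *\<^sub>C x"
    and scaleC_one: "1 *\<^sub>C x = x"
    and scaleR_scaleC: "r *\<^sub>R x = complex_of_real r *\<^sub>C x"
    and cinner_commute: "cinner x y = cnj (cinner y x)"
    and cinner_add_left: "cinner (x + y) z = cinner x z + cinner y z"
    and cinner_scaleC_left: "cinner (c *\<^sub>C x) y = c * cinner x y"
    and cinner_ge_zero: "0 \<le> Re (cinner x x)"
    and cinner_eq_zero_iff: "cinner x x = 0 \<longleftrightarrow> x = 0"
    and norm_eq_sqrt_cinner: "norm x = sqrt (Re (cinner x x))"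

instantiation complex :: complex_hilbert_space
begin

definition scaleC_complex :: "complex \<Rightarrow> complex \<Rightarrow> complex"
  where "scaleC_complex c x = c * x"

definition cinner_complex :: "complex \<Rightarrow> complex \<Rightarrow> complex"
  where "cinner_complex x y = x * cnj y"

instance
  by standard
    (auto simp: scaleC_complex_def cinner_complex_def algebra_simps scaleR_conv_of_real
      cmod_def power2_eq_square)

end

global_interpretation complex_vector: vector_space "scaleC :: complex \<Rightarrow> 'a \<Rightarrow> 'a::complex_hilbert_space"
  by standard (simp_all add: scaleC_add_right scaleC_add_left scaleC_scaleC scaleC_one)

definition bounded_operators :: "('h::complex_hilbert_space \<Rightarrow> 'h) set"
  where "bounded_operators =
    {f. Vector_Spaces.linear scaleC scaleC f \<and> (\<exists>K. \<forall>x. norm (f x) \<le> K * norm x)}"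

definition unitary_group :: "('h::complex_hilbert_space \<Rightarrow> 'h) monoid"
  where "unitary_group =
    \<lparr>carrier = {u. Vector_Spaces.linear scaleC scaleC u \<and> surj u \<and>
                   (\<forall>x y. cinner (u x) (u y) = cinner x y)},
     mult = (\<circ>), one = id\<rparr>"

text \<open>Elements of $l^2(G)$ are functions vanishing off the carrier, and an operator on $l^2(G)$
  is a function on all of \<open>'g \<Rightarrow> complex\<close> that is set to \<open>0\<close> outside $l^2(G)$; with this
  convention two operators are equal as HOL functions iff they agree on $l^2(G)$.\<close>

definition l2 :: "('g, 'm) monoid_scheme \<Rightarrow> ('g \<Rightarrow> complex) set"
  where "l2 G = {a. (\<forall>h. h \<notin> carrier G \<longrightarrow> a h = 0) \<and>
                    (\<lambda>h. (cmod (a h))\<^sup>2) summable_on carrier G}"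

definition l2_inner :: "('g, 'm) monoid_scheme \<Rightarrow> ('g \<Rightarrow> complex) \<Rightarrow> ('g \<Rightarrow> complex) \<Rightarrow> complex"
  where "l2_inner G a b = (\<Sum>\<^sub>\<infinity>h\<in>carrier G. a h * cnj (b h))"

definition left_regular ::
    "('g, 'm) monoid_scheme \<Rightarrow> 'g \<Rightarrow> ('g \<Rightarrow> complex) \<Rightarrow> ('g \<Rightarrow> complex)"
  where "left_regular G g a =
    (if a \<in> l2 G then (\<lambda>h. if h \<in> carrier G then a (inv\<^bsub>G\<^esub> g \<otimes>\<^bsub>G\<^esub> h) else 0) else (\<lambda>h. 0))"

definition lambda_sum ::
    "('g, 'm) monoid_scheme \<Rightarrow> 'g set \<Rightarrow> ('g \<Rightarrow> complex) \<Rightarrow> ('g \<Rightarrow> complex) \<Rightarrow> ('g \<Rightarrow> complex)"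
  where "lambda_sum G F c = (\<lambda>x h. \<Sum>g\<in>F. c g * left_regular G g x h)"

definition group_algebra ::
    "('g, 'm) monoid_scheme \<Rightarrow> (('g \<Rightarrow> complex) \<Rightarrow> ('g \<Rightarrow> complex)) set"
  where "group_algebra G = {lambda_sum G F c | F c. finite F \<and> F \<subseteq> carrier G}"

definition l2_adjoint ::
    "('g, 'm) monoid_scheme \<Rightarrow> (('g \<Rightarrow> complex) \<Rightarrow> ('g \<Rightarrow> complex)) \<Rightarrow>
     (('g \<Rightarrow> complex) \<Rightarrow> ('g \<Rightarrow> complex)) \<Rightarrow> bool"
  where "l2_adjoint G a b \<longleftrightarrow>
    (\<forall>x\<in>l2 G. \<forall>y\<in>l2 G. l2_inner G (a x) y = l2_inner G x (b y))"

definition star_representation ::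
    "('g, 'm) monoid_scheme \<Rightarrow>
     ((('g \<Rightarrow> complex) \<Rightarrow> ('g \<Rightarrow> complex)) \<Rightarrow> 'h::complex_hilbert_space \<Rightarrow> 'h) \<Rightarrow> bool"
  where "star_representation G \<pi> \<longleftrightarrow>
    (\<forall>a\<in>group_algebra G. \<pi> a \<in> bounded_operators) \<and>
    (\<forall>a\<in>group_algebra G. \<forall>b\<in>group_algebra G.
       \<pi> (\<lambda>x h. a x h + b x h) = (\<lambda>\<zeta>. \<pi> a \<zeta> + \<pi> b \<zeta>)) \<and>
    (\<forall>a\<in>group_algebra G. \<forall>z. \<pi> (\<lambda>x h. z * a x h) = (\<lambda>\<zeta>. z *\<^sub>C \<pi> a \<zeta>)) \<and>
    (\<forall>a\<in>group_algebra G. \<forall>b\<in>group_algebra G. \<pi> (a \<circ> b) = \<pi> a \<circ> \<pi> b) \<and>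
    (\<forall>a\<in>group_algebra G. \<forall>b\<in>group_algebra G. l2_adjoint G a b \<longrightarrow>
       (\<forall>\<zeta> \<eta>. cinner (\<pi> a \<zeta>) \<eta> = cinner \<zeta> (\<pi> b \<eta>)))"

definition l2_delta :: "'g \<Rightarrow> 'g \<Rightarrow> complex"
  where "l2_delta g = (\<lambda>h. if h = g then 1 else 0)"

text \<open>The *-homomorphism $\pi_0$ with $\pi_0(\lambda_g)=\nu_g$. The coefficient of $\lambda_g$ in
  $a=\sum_g c_g\lambda_g$ is $c_g=(a\delta_1)_g$, so $\pi_0(a)=\sum_g (a\delta_1)_g\nu_g$. That this
  is a *-homomorphism, and the only one with $\pi_0(\lambda_g)=\nu_g$, is proved below.\<close>

definition pi0 ::
    "('g, 'm) monoid_scheme \<Rightarrow> ('g \<Rightarrow> 'h::complex_hilbert_space \<Rightarrow> 'h) \<Rightarrow>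
     (('g \<Rightarrow> complex) \<Rightarrow> ('g \<Rightarrow> complex)) \<Rightarrow> 'h \<Rightarrow> 'h"
  where "pi0 G \<nu> a \<zeta> =
    (\<Sum>g | g \<in> carrier G \<and> a (l2_delta \<one>\<^bsub>G\<^esub>) g \<noteq> 0. a (l2_delta \<one>\<^bsub>G\<^esub>) g *\<^sub>C \<nu> g \<zeta>)"

lemma l2_delta_in_l2: "g \<in> carrier G \<Longrightarrow> l2_delta g \<in> l2 G"
proof -
  assume g: "g \<in> carrier G"
  have "(\<lambda>h. (cmod (l2_delta g h))\<^sup>2) summable_on {g}" by simp
  then have "(\<lambda>h. (cmod (l2_delta g h))\<^sup>2) summable_on carrier G"
    by (rule summable_on_cong_neutral[THEN iffD1, rotated -1]) (use g in \<open>auto simp: l2_delta_def\<close>)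
  then show ?thesis using g by (auto simp: l2_def l2_delta_def)
qed

context group
begin

lemma left_regular_delta:
  assumes "g \<in> carrier G" "k \<in> carrier G"
  shows "left_regular G g (l2_delta k) = l2_delta (g \<otimes> k)"
proof
  fix h
  have "inv g \<otimes> h = k \<longleftrightarrow> h = g \<otimes> k" if "h \<in> carrier G"
    using assms that by (metis inv_closed inv_solve_left m_closed)
  then show "left_regular G g (l2_delta k) h = l2_delta (g \<otimes> k) h"
    using assms l2_delta_in_l2[of k G] by (auto simp: left_regular_def l2_delta_def)
qed

lemma left_regular_in_l2:
  assumes "g \<in> carrier G"
  shows "left_regular G g x \<in> l2 G"
proof (cases "x \<in> l2 G")
  case True
  have bij: "bij_betw (\<lambda>h. inv g \<otimes> h) (carrier G) (carrier G)"
    by (rule bij_betwI[where g = "\<lambda>h. g \<otimes> h"]) (use assms in \<open>auto simp: m_assoc[symmetric]\<close>)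
  have "(\<lambda>h. (cmod (x h))\<^sup>2) summable_on carrier G"
    using True by (auto simp: l2_def)
  then have "(\<lambda>h. (cmod (x (inv g \<otimes> h)))\<^sup>2) summable_on carrier G"
    using summable_on_reindex_bij_betw[OF bij, of "\<lambda>h. (cmod (x h))\<^sup>2"] by simp
  then have "(\<lambda>h. (cmod (left_regular G g x h))\<^sup>2) summable_on carrier G"
    by (rule summable_on_cong[THEN iffD1, rotated]) (use True in \<open>auto simp: left_regular_def\<close>)
  then show ?thesis using True by (auto simp: l2_def left_regular_def)
next
  case False
  then show ?thesis by (auto simp: l2_def left_regular_def)
qed

lemma left_regular_mult:
  assumes "g \<in> carrier G" "k \<in> carrier G"
  shows "left_regular G g (left_regular G k x) = left_regular G (g \<otimes> k) x"
proof (cases "x \<in> l2 G")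
  case True
  have "left_regular G k x \<in> l2 G" by (rule left_regular_in_l2) fact
  then show ?thesis
    using True assms by (auto simp: left_regular_def fun_eq_iff inv_mult_group m_assoc)
next
  case False
  then show ?thesis using assms by (auto simp: left_regular_def fun_eq_iff)
qed

lemma l2_zero: "(\<lambda>h. 0) \<in> l2 G"
  by (simp add: l2_def)

lemma l2_scale:
  assumes "x \<in> l2 G"
  shows "(\<lambda>h. c * x h) \<in> l2 G"
  using assms by (auto simp: l2_def norm_mult power_mult_distrib intro: summable_on_cmult_right)

lemma l2_add:
  assumes "x \<in> l2 G" "y \<in> l2 G"
  shows "(\<lambda>h. x h + y h) \<in> l2 G"
proof -
  have "(\<lambda>h. 2 * (cmod (x h))\<^sup>2 + 2 * (cmod (y h))\<^sup>2) summable_on carrier G"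
    using assms by (intro summable_on_add summable_on_cmult_right) (auto simp: l2_def)
  moreover have "(cmod (x h + y h))\<^sup>2 \<le> 2 * (cmod (x h))\<^sup>2 + 2 * (cmod (y h))\<^sup>2" for h
  proof -
    have "(cmod (x h + y h))\<^sup>2 \<le> (cmod (x h) + cmod (y h))\<^sup>2"
      by (simp add: norm_triangle_ineq power_mono)
    also have "\<dots> \<le> 2 * (cmod (x h))\<^sup>2 + 2 * (cmod (y h))\<^sup>2"
      using sum_squares_bound[of "cmod (x h)" "cmod (y h)"] by (simp add: power2_sum)
    finally show ?thesis .
  qed
  ultimately have "(\<lambda>h. (cmod (x h + y h))\<^sup>2) summable_on carrier G"
    by (rule summable_on_comparison_test) auto
  then show ?thesis using assms by (auto simp: l2_def)
qed

lemma l2_sum: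
  assumes "finite F" "\<And>g. g \<in> F \<Longrightarrow> x g \<in> l2 G"
  shows "(\<lambda>h. \<Sum>g\<in>F. x g h) \<in> l2 G"
  using assms by (induction F rule: finite_induct) (auto simp: l2_zero intro: l2_add)

lemma left_regular_add:
  assumes "g \<in> carrier G" "x \<in> l2 G" "y \<in> l2 G"
  shows "left_regular G g (\<lambda>h. x h + y h) = (\<lambda>h. left_regular G g x h + left_regular G g y h)"
  using assms l2_add by (auto simp: left_regular_def fun_eq_iff)

lemma left_regular_scale:
  assumes "g \<in> carrier G" "x \<in> l2 G"
  shows "left_regular G g (\<lambda>h. c * x h) = (\<lambda>h. c * left_regular G g x h)"
  using assms l2_scale by (auto simp: left_regular_def fun_eq_iff)

lemma left_regular_sum:
  assumes "g \<in> carrier G" "finite F" "\<And>k. k \<in> F \<Longrightarrow> x k \<in> l2 G"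
  shows "left_regular G g (\<lambda>h. \<Sum>k\<in>F. x k h) = (\<lambda>h. \<Sum>k\<in>F. left_regular G g (x k) h)"
  using assms l2_sum[OF assms(2,3)] by (auto simp: left_regular_def fun_eq_iff intro!: sum.cong)

lemma lambda_sum_coeff:
  assumes "finite F" "F \<subseteq> carrier G"
  shows "lambda_sum G F c (l2_delta \<one>) = (\<lambda>h. if h \<in> F then c h else 0)"
proof
  fix h
  have "lambda_sum G F c (l2_delta \<one>) h = (\<Sum>g\<in>F. c g * l2_delta g h)"
    unfolding lambda_sum_def using assms
    by (intro sum.cong refl) (auto simp: left_regular_delta subset_iff)
  also have "\<dots> = (\<Sum>g\<in>F. if h = g then c g else 0)"
    by (intro sum.cong refl) (auto simp: l2_delta_def)
  also have "\<dots> = (if h \<in> F then c h else 0)"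
    using assms by simp
  finally show "lambda_sum G F c (l2_delta \<one>) h = (if h \<in> F then c h else 0)" .
qed

lemma pi0_lambda_sum:
  assumes "finite F" "F \<subseteq> carrier G"
  shows "pi0 G \<nu> (lambda_sum G F c) \<zeta> = (\<Sum>g\<in>F. c g *\<^sub>C \<nu> g \<zeta>)"
proof -
  have eq: "{g \<in> carrier G. lambda_sum G F c (l2_delta \<one>) g \<noteq> 0} = {g \<in> F. c g \<noteq> 0}"
    using assms by (auto simp: lambda_sum_coeff)
  have "pi0 G \<nu> (lambda_sum G F c) \<zeta> = (\<Sum>g | g \<in> F \<and> c g \<noteq> 0. c g *\<^sub>C \<nu> g \<zeta>)"
    unfolding pi0_def eq using assms by (intro sum.cong refl) (auto simp: lambda_sum_coeff)
  also have "\<dots> = (\<Sum>g\<in>F. c g *\<^sub>C \<nu> g \<zeta>)"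
    using assms by (intro sum.mono_neutral_left) auto
  finally show ?thesis .
qed

lemma lambda_sum_single: "lambda_sum G {g} (\<lambda>_. 1) = left_regular G g"
  by (auto simp: lambda_sum_def fun_eq_iff)

lemma pi0_left_regular:
  assumes "g \<in> carrier G"
  shows "pi0 G \<nu> (left_regular G g) = \<nu> g"
  using pi0_lambda_sum[of "{g}" \<nu> "\<lambda>_. 1"] assms
  by (auto simp: lambda_sum_single scaleC_one fun_eq_iff)

lemma lambda_sum_extend:
  assumes "finite F'" "F \<subseteq> F'"
  shows "lambda_sum G F c = lambda_sum G F' (\<lambda>g. if g \<in> F then c g else 0)"
proof (intro ext)
  fix x h
  have "(\<Sum>g\<in>F'. (if g \<in> F then c g else 0) * left_regular G g x h) =
        (\<Sum>g\<in>F. (if g \<in> F then c g else 0) * left_regular G g x h)"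
    using assms by (intro sum.mono_neutral_right) auto
  then show "lambda_sum G F c x h = lambda_sum G F' (\<lambda>g. if g \<in> F then c g else 0) x h"
    by (simp add: lambda_sum_def)
qed

lemma group_algebraE:
  assumes "a \<in> group_algebra G"
  obtains F c where "finite F" "F \<subseteq> carrier G" "a = lambda_sum G F c"
  using assms by (auto simp: group_algebra_def)

lemma lambda_sum_in: "finite F \<Longrightarrow> F \<subseteq> carrier G \<Longrightarrow> lambda_sum G F c \<in> group_algebra G"
  by (auto simp: group_algebra_def)

lemma lambda_sum_in_l2:
  assumes "finite F" "F \<subseteq> carrier G"
  shows "lambda_sum G F c x \<in> l2 G"
  unfolding lambda_sum_def using assms
  by (intro l2_sum l2_scale left_regular_in_l2) auto

lemma lambda_sum_comp:
  assumes "finite F" "F \<subseteq> carrier G" "finite F'" "F' \<subseteq> carrier G"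
  shows "lambda_sum G F c (lambda_sum G F' c' x) h =
         (\<Sum>g\<in>F. \<Sum>k\<in>F'. c g * c' k * left_regular G (g \<otimes> k) x h)"
proof -
  have "left_regular G g (lambda_sum G F' c' x) h = (\<Sum>k\<in>F'. c' k * left_regular G (g \<otimes> k) x h)"
    if "g \<in> F" for g
  proof -
    have g: "g \<in> carrier G" using that assms by auto
    have "left_regular G g (lambda_sum G F' c' x) h =
          (\<Sum>k\<in>F'. left_regular G g (\<lambda>h. c' k * left_regular G k x h) h)"
      unfolding lambda_sum_def
      by (subst left_regular_sum) (use g assms in \<open>auto intro!: l2_scale left_regular_in_l2\<close>)
    also have "\<dots> = (\<Sum>k\<in>F'. c' k * left_regular G (g \<otimes> k) x h)"
      using g assms
      by (intro sum.cong refl)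
        (auto simp: left_regular_scale left_regular_in_l2 left_regular_mult subset_iff)
    finally show ?thesis .
  qed
  then have "lambda_sum G F c (lambda_sum G F' c' x) h =
      (\<Sum>g\<in>F. c g * (\<Sum>k\<in>F'. c' k * left_regular G (g \<otimes> k) x h))"
    by (simp add: lambda_sum_def[of G F])
  then show ?thesis by (simp add: sum_distrib_left mult.assoc)
qed

lemma lambda_sum_image:
  assumes "finite P"
  shows "(\<lambda>x h. \<Sum>p\<in>P. c p * left_regular G (m p) x h) =
         lambda_sum G (m ` P) (\<lambda>l. \<Sum>p | p \<in> P \<and> m p = l. c p)"
proof (intro ext)
  fix x h
  have "(\<Sum>p\<in>P. c p * left_regular G (m p) x h) =
        (\<Sum>l\<in>m ` P. \<Sum>p | p \<in> P \<and> m p = l. c p * left_regular G (m p) x h)"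
    by (rule sum.image_gen) fact
  also have "\<dots> = (\<Sum>l\<in>m ` P. (\<Sum>p | p \<in> P \<and> m p = l. c p) * left_regular G l x h)"
    by (intro sum.cong refl) (simp add: sum_distrib_right)
  finally show "(\<Sum>p\<in>P. c p * left_regular G (m p) x h) =
      lambda_sum G (m ` P) (\<lambda>l. \<Sum>p | p \<in> P \<and> m p = l. c p) x h"
    by (simp add: lambda_sum_def)
qed

lemma pi0_image:
  assumes "finite P" "m ` P \<subseteq> carrier G"
  shows "pi0 G \<nu> (\<lambda>x h. \<Sum>p\<in>P. c p * left_regular G (m p) x h) \<zeta> = (\<Sum>p\<in>P. c p *\<^sub>C \<nu> (m p) \<zeta>)"
proof -
  have "(\<Sum>p\<in>P. c p *\<^sub>C \<nu> (m p) \<zeta>) =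
        (\<Sum>l\<in>m ` P. \<Sum>p | p \<in> P \<and> m p = l. c p *\<^sub>C \<nu> (m p) \<zeta>)"
    by (rule sum.image_gen) fact
  also have "\<dots> = (\<Sum>l\<in>m ` P. (\<Sum>p | p \<in> P \<and> m p = l. c p) *\<^sub>C \<nu> l \<zeta>)"
    by (intro sum.cong refl) (simp add: complex_vector.scale_sum_left)
  finally show ?thesis
    using assms by (simp add: lambda_sum_image pi0_lambda_sum)
qed

lemma lambda_sum_comp_image:
  assumes "finite F" "F \<subseteq> carrier G" "finite F'" "F' \<subseteq> carrier G"
  shows "lambda_sum G F c \<circ> lambda_sum G F' c' =
    (\<lambda>x h. \<Sum>p\<in>F \<times> F'. (c (fst p) * c' (snd p)) * left_regular G (fst p \<otimes> snd p) x h)"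
  using assms by (auto simp: fun_eq_iff lambda_sum_comp sum.cartesian_product case_prod_unfold)

lemma group_algebra_comp:
  assumes "a \<in> group_algebra G" "b \<in> group_algebra G"
  shows "a \<circ> b \<in> group_algebra G"
proof -
  obtain F c where a: "finite F" "F \<subseteq> carrier G" "a = lambda_sum G F c"
    using assms(1) by (rule group_algebraE)
  obtain F' c' where b: "finite F'" "F' \<subseteq> carrier G" "b = lambda_sum G F' c'"
    using assms(2) by (rule group_algebraE)
  have "(\<lambda>p. fst p \<otimes> snd p) ` (F \<times> F') \<subseteq> carrier G" using a(2) b(2) by (auto simp: subset_iff)
  then show ?thesis
    using a b by (simp add: lambda_sum_comp_image lambda_sum_image lambda_sum_in)
qed

lemma l2_inner_summable:
  assumes "x \<in> l2 G" "y \<in> l2 G"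
  shows "(\<lambda>h. x h * cnj (y h)) summable_on carrier G"
proof -
  have "(\<lambda>h. (cmod (x h))\<^sup>2 + (cmod (y h))\<^sup>2) summable_on carrier G"
    using assms by (intro summable_on_add) (auto simp: l2_def)
  moreover have "norm (x h * cnj (y h)) \<le> (cmod (x h))\<^sup>2 + (cmod (y h))\<^sup>2" for h
  proof -
    have "0 \<le> cmod (x h) * cmod (y h)" by simp
    then show ?thesis
      using sum_squares_bound[of "cmod (x h)" "cmod (y h)"] unfolding norm_mult complex_mod_cnj
      by linarith
  qed
  ultimately have "(\<lambda>h. norm (x h * cnj (y h))) summable_on carrier G"
    by (rule summable_on_comparison_test) auto
  then show ?thesis by (rule abs_summable_summable)
qed

lemma l2_inner_left_regular:
  assumes g: "g \<in> carrier G" and x: "x \<in> l2 G" and y: "y \<in> l2 G"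
  shows "l2_inner G (left_regular G g x) y = l2_inner G x (left_regular G (inv g) y)"
proof -
  have bij: "bij_betw (\<lambda>h. g \<otimes> h) (carrier G) (carrier G)"
    by (rule bij_betwI[where g = "\<lambda>h. inv g \<otimes> h"]) (use g in \<open>auto simp: m_assoc[symmetric]\<close>)
  have "l2_inner G (left_regular G g x) y =
        (\<Sum>\<^sub>\<infinity>h\<in>carrier G. left_regular G g x (g \<otimes> h) * cnj (y (g \<otimes> h)))"
    unfolding l2_inner_def by (rule infsum_reindex_bij_betw[OF bij, symmetric])
  also have "\<dots> = l2_inner G x (left_regular G (inv g) y)"
    unfolding l2_inner_def
    using g x y by (intro infsum_cong) (auto simp: left_regular_def m_assoc[symmetric])
  finally show ?thesis .
qed

lemma l2_inner_sum_left:
  assumes "finite F" "\<And>g. g \<in> F \<Longrightarrow> x g \<in> l2 G" "y \<in> l2 G"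
  shows "l2_inner G (\<lambda>h. \<Sum>g\<in>F. c g * x g h) y = (\<Sum>g\<in>F. c g * l2_inner G (x g) y)"
proof -
  have "((\<lambda>h. \<Sum>g\<in>F. c g * (x g h * cnj (y h))) has_sum (\<Sum>g\<in>F. c g * l2_inner G (x g) y))
          (carrier G)"
    using assms(1,2)
  proof (induction F rule: finite_induct)
    case (insert g F)
    have "((\<lambda>h. c g * (x g h * cnj (y h))) has_sum (c g * l2_inner G (x g) y)) (carrier G)"
      unfolding l2_inner_def using insert assms(3)
      by (intro has_sum_cmult_right has_sum_infsum l2_inner_summable) auto
    then show ?case using insert by (auto intro: has_sum_add)
  qed auto
  then show ?thesis
    by (simp add: l2_inner_def[of G "\<lambda>h. \<Sum>g\<in>F. c g * x g h"] sum_distrib_right mult.assoc infsumI)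
qed

lemma l2_inner_commute: "l2_inner G x y = cnj (l2_inner G y x)"
  by (simp add: l2_inner_def infsum_cnj[symmetric] mult.commute del: infsum_cnj)

lemma group_algebra_adjoint:
  assumes "a \<in> group_algebra G"
  obtains b where "b \<in> group_algebra G" "l2_adjoint G a b"
proof -
  obtain F c where a: "finite F" "F \<subseteq> carrier G" "a = lambda_sum G F c"
    using assms by (rule group_algebraE)
  define b where "b = (\<lambda>x h. \<Sum>g\<in>F. cnj (c g) * left_regular G (inv g) x h)"
  have F: "g \<in> carrier G" if "g \<in> F" for g using a that by auto
  have "b \<in> group_algebra G"
    unfolding b_def using a by (subst lambda_sum_image) (auto intro!: lambda_sum_in)
  moreover have "l2_adjoint G a b"
    unfolding l2_adjoint_def
  proof (intro ballI)
    fix x y assume xy: "x \<in> l2 G" "y \<in> l2 G"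
    have "l2_inner G (a x) y = (\<Sum>g\<in>F. c g * l2_inner G (left_regular G g x) y)"
      unfolding a(3) lambda_sum_def
      by (rule l2_inner_sum_left) (use a F xy in \<open>auto intro: left_regular_in_l2\<close>)
    also have "\<dots> = (\<Sum>g\<in>F. c g * l2_inner G x (left_regular G (inv g) y))"
      using F xy by (intro sum.cong refl) (simp add: l2_inner_left_regular)
    also have "\<dots> = cnj (\<Sum>g\<in>F. cnj (c g) * l2_inner G (left_regular G (inv g) y) x)"
      by (simp add: l2_inner_commute[of x])
    also have "(\<Sum>g\<in>F. cnj (c g) * l2_inner G (left_regular G (inv g) y) x) = l2_inner G (b y) x"
      unfolding b_def
      by (rule l2_inner_sum_left[symmetric]) (use a F xy in \<open>auto intro: left_regular_in_l2\<close>)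
    finally show "l2_inner G (a x) y = l2_inner G x (b y)"
      by (simp add: l2_inner_commute[of x])
  qed
  ultimately show thesis by (rule that)
qed

lemma lambda_sum_delta:
  assumes "finite F" "F \<subseteq> carrier G" "k \<in> carrier G"
  shows "lambda_sum G F c (l2_delta k) \<one> = (if inv k \<in> F then c (inv k) else 0)"
proof -
  have "lambda_sum G F c (l2_delta k) \<one> = (\<Sum>g\<in>F. if inv k = g then c g else 0)"
    unfolding lambda_sum_def
  proof (intro sum.cong refl)
    fix g assume "g \<in> F"
    then have g: "g \<in> carrier G" using assms by auto
    have "\<one> = g \<otimes> k \<longleftrightarrow> inv k = g"
      using g assms(3) by (metis inv_equality r_inv inv_inv inv_closed)
    then show "c g * left_regular G g (l2_delta k) \<one> = (if inv k = g then c g else 0)"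
      using g assms(3) by (simp add: left_regular_delta) (simp add: l2_delta_def)
  qed
  then show ?thesis using assms by simp
qed

lemma l2_inner_delta_left:
  assumes "k \<in> carrier G"
  shows "l2_inner G (l2_delta k) y = cnj (y k)"
proof -
  have "l2_inner G (l2_delta k) y = (\<Sum>\<^sub>\<infinity>h\<in>{k}. l2_delta k h * cnj (y h))"
    unfolding l2_inner_def by (rule infsum_cong_neutral) (use assms in \<open>auto simp: l2_delta_def\<close>)
  then show ?thesis by (simp add: l2_delta_def)
qed

lemma adjoint_coeff:
  assumes S: "finite S" "S \<subseteq> carrier G" "\<And>g. g \<in> S \<Longrightarrow> inv g \<in> S"
    and adj: "l2_adjoint G (lambda_sum G S c) (lambda_sum G S c')" and k: "k \<in> S"
  shows "c' k = cnj (c (inv k))"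
proof -
  have kG: "k \<in> carrier G" using S k by auto
  have "l2_inner G (lambda_sum G S c (l2_delta k)) (l2_delta \<one>) =
        l2_inner G (l2_delta k) (lambda_sum G S c' (l2_delta \<one>))"
    using adj kG l2_delta_in_l2[of _ G] by (auto simp: l2_adjoint_def)
  moreover have "l2_inner G (lambda_sum G S c (l2_delta k)) (l2_delta \<one>) = c (inv k)"
    using S k kG by (subst l2_inner_commute) (simp add: l2_inner_delta_left lambda_sum_delta)
  moreover have "l2_inner G (l2_delta k) (lambda_sum G S c' (l2_delta \<one>)) = cnj (c' k)"
    using S k kG by (simp add: l2_inner_delta_left lambda_sum_coeff)
  ultimately show ?thesis by simp
qed

lemma group_algebra_common:
  assumes "a \<in> group_algebra G" "b \<in> group_algebra G"
  obtains S c c' where "finite S" "S \<subseteq> carrier G" "\<And>g. g \<in> S \<Longrightarrow> inv g \<in> S"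
    "a = lambda_sum G S c" "b = lambda_sum G S c'"
proof -
  obtain F c where a: "finite F" "F \<subseteq> carrier G" "a = lambda_sum G F c"
    using assms(1) by (rule group_algebraE)
  obtain F' c' where b: "finite F'" "F' \<subseteq> carrier G" "b = lambda_sum G F' c'"
    using assms(2) by (rule group_algebraE)
  define S where "S = F \<union> F' \<union> m_inv G ` (F \<union> F')"
  have S: "finite S" "S \<subseteq> carrier G" "F \<subseteq> S" "F' \<subseteq> S"
    using a b by (auto simp: S_def)
  have "inv g \<in> S" if "g \<in> S" for g
    using that a b by (auto simp: S_def subset_iff)
  then show thesis
    using that[of S "\<lambda>g. if g \<in> F then c g else 0" "\<lambda>g. if g \<in> F' then c' g else 0"]
      S a(3) b(3) lambda_sum_extend[OF S(1,3)] lambda_sum_extend[OF S(1,4)] by simp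
qed

end

lemma cinner_add_right:
  fixes x :: "'h::complex_hilbert_space"
  shows "cinner x (y + z) = cinner x y + cinner x z"
  by (metis cinner_add_left cinner_commute complex_cnj_add)

lemma cinner_scaleC_right:
  fixes x :: "'h::complex_hilbert_space"
  shows "cinner x (c *\<^sub>C y) = cnj c * cinner x y"
  by (metis cinner_scaleC_left cinner_commute complex_cnj_mult)

lemma cinner_zero_left: "cinner 0 (x :: 'h::complex_hilbert_space) = 0"
  using cinner_add_left[of 0 0 x] by simp

lemma cinner_sum_left:
  "cinner (\<Sum>i\<in>I. f i) (x :: 'h::complex_hilbert_space) = (\<Sum>i\<in>I. cinner (f i) x)"
  by (induction I rule: infinite_finite_induct) (auto simp: cinner_zero_left cinner_add_left)

lemma cinner_sum_right:
  "cinner (x :: 'h::complex_hilbert_space) (\<Sum>i\<in>I. f i) = (\<Sum>i\<in>I. cinner x (f i))"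
  by (subst (1 2) cinner_commute) (simp add: cinner_sum_left)

lemma norm_scaleC: "norm (c *\<^sub>C (x :: 'h::complex_hilbert_space)) = cmod c * norm x"
proof -
  have "cinner (c *\<^sub>C x) (c *\<^sub>C x) = of_real ((cmod c)\<^sup>2) * cinner x x"
    by (simp add: cinner_scaleC_left cinner_scaleC_right complex_norm_square mult.assoc
          del: of_real_power)
  then have "Re (cinner (c *\<^sub>C x) (c *\<^sub>C x)) = (cmod c)\<^sup>2 * Re (cinner x x)"
    by (simp del: of_real_power)
  then show ?thesis
    by (simp add: norm_eq_sqrt_cinner[of "c *\<^sub>C x"] norm_eq_sqrt_cinner[of x] real_sqrt_mult)
qed

locale unitary_representation = group G for G :: "('g, 'm) monoid_scheme" (structure) +
  fixes \<nu> :: "'g \<Rightarrow> 'h::complex_hilbert_space \<Rightarrow> 'h"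
  assumes rep: "\<nu> \<in> hom G unitary_group"
begin

lemma rep_linear: "g \<in> carrier G \<Longrightarrow> Vector_Spaces.linear scaleC scaleC (\<nu> g)"
  using rep by (auto simp: hom_def unitary_group_def)

lemma rep_mult: "g \<in> carrier G \<Longrightarrow> k \<in> carrier G \<Longrightarrow> \<nu> (g \<otimes> k) \<zeta> = \<nu> g (\<nu> k \<zeta>)"
  using rep by (auto simp: hom_def unitary_group_def)

lemma rep_cinner: "g \<in> carrier G \<Longrightarrow> cinner (\<nu> g \<zeta>) (\<nu> g \<eta>) = cinner \<zeta> \<eta>"
  using rep by (auto simp: hom_def unitary_group_def)

lemma rep_norm: "g \<in> carrier G \<Longrightarrow> norm (\<nu> g \<zeta>) = norm \<zeta>"
  by (simp add: norm_eq_sqrt_cinner rep_cinner)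

lemma rep_one: "\<nu> \<one> \<zeta> = \<zeta>"
proof -
  have "surj (\<nu> \<one>)" using rep by (auto simp: hom_def unitary_group_def)
  then obtain \<eta> where "\<zeta> = \<nu> \<one> \<eta>" by auto
  then show ?thesis using rep_mult[of \<one> \<one> \<eta>] by simp
qed

lemma rep_adjoint: "g \<in> carrier G \<Longrightarrow> cinner (\<nu> g \<zeta>) \<eta> = cinner \<zeta> (\<nu> (inv g) \<eta>)"
  using rep_cinner[of g \<zeta> "\<nu> (inv g) \<eta>"] rep_mult[of g "inv g" \<eta>] by (simp add: rep_one)

lemma pi0_bounded:
  assumes "a \<in> group_algebra G"
  shows "pi0 G \<nu> a \<in> bounded_operators"
proof -
  obtain F c where a: "finite F" "F \<subseteq> carrier G" "a = lambda_sum G F c"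
    using assms by (rule group_algebraE)
  have F: "g \<in> carrier G" if "g \<in> F" for g using a that by auto
  have pi: "pi0 G \<nu> a = (\<lambda>\<zeta>. \<Sum>g\<in>F. c g *\<^sub>C \<nu> g \<zeta>)"
    unfolding a(3) using a(1,2) by (auto simp: pi0_lambda_sum)
  have add: "\<nu> g (x + y) = \<nu> g x + \<nu> g y" and scale: "\<nu> g (z *\<^sub>C x) = z *\<^sub>C \<nu> g x"
    if "g \<in> F" for g x y z
    using rep_linear[OF F[OF that]]
    by (auto simp: Vector_Spaces.linear_iff)
  have "Vector_Spaces.linear scaleC scaleC (pi0 G \<nu> a)"
    unfolding Vector_Spaces.linear_iff pi
    by (auto simp: complex_vector.vector_space_axioms add scale scaleC_add_right sum.distrib
        complex_vector.scale_sum_right scaleC_scaleC mult.commute)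
  moreover have "norm (pi0 G \<nu> a x) \<le> (\<Sum>g\<in>F. cmod (c g)) * norm x" for x
  proof -
    have "norm (pi0 G \<nu> a x) \<le> (\<Sum>g\<in>F. norm (c g *\<^sub>C \<nu> g x))"
      unfolding pi by (rule norm_sum)
    then show ?thesis by (simp add: norm_scaleC rep_norm F sum_distrib_right)
  qed
  ultimately show ?thesis by (auto simp: bounded_operators_def)
qed

theorem star_representation_pi0: "star_representation G (pi0 G \<nu>)"
  unfolding star_representation_def
proof (intro conjI ballI allI impI)
  fix a assume "a \<in> group_algebra G"
  then show "pi0 G \<nu> a \<in> bounded_operators" by (rule pi0_bounded)
next
  fix a b assume "a \<in> group_algebra G" "b \<in> group_algebra G"
  then obtain S c c' where S: "finite S" "S \<subseteq> carrier G" "\<And>g. g \<in> S \<Longrightarrow> inv g \<in> S"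
    "a = lambda_sum G S c" "b = lambda_sum G S c'"
    using group_algebra_common by metis
  have "(\<lambda>x h. a x h + b x h) = lambda_sum G S (\<lambda>g. c g + c' g)"
    by (simp add: S lambda_sum_def fun_eq_iff sum.distrib distrib_right)
  then show "pi0 G \<nu> (\<lambda>x h. a x h + b x h) = (\<lambda>\<zeta>. pi0 G \<nu> a \<zeta> + pi0 G \<nu> b \<zeta>)"
    unfolding S(4,5) using S(1,2)
    by (auto simp: pi0_lambda_sum sum.distrib scaleC_add_left S(4,5))
next
  fix a z assume "a \<in> group_algebra G"
  then obtain F c where a: "finite F" "F \<subseteq> carrier G" "a = lambda_sum G F c"
    by (rule group_algebraE)
  have "(\<lambda>x h. z * a x h) = lambda_sum G F (\<lambda>g. z * c g)"
    by (simp add: a lambda_sum_def fun_eq_iff sum_distrib_left mult.assoc)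
  then show "pi0 G \<nu> (\<lambda>x h. z * a x h) = (\<lambda>\<zeta>. z *\<^sub>C pi0 G \<nu> a \<zeta>)"
    unfolding a(3) using a(1,2)
    by (auto simp: pi0_lambda_sum complex_vector.scale_sum_right)
next
  fix a b assume "a \<in> group_algebra G" "b \<in> group_algebra G"
  then obtain S c c' where S: "finite S" "S \<subseteq> carrier G" "\<And>g. g \<in> S \<Longrightarrow> inv g \<in> S"
    "a = lambda_sum G S c" "b = lambda_sum G S c'"
    using group_algebra_common by metis
  have im: "(\<lambda>p. fst p \<otimes> snd p) ` (S \<times> S) \<subseteq> carrier G" using S(2) by (auto simp: subset_iff)
  have lin: "\<nu> g (\<Sum>k\<in>S. c' k *\<^sub>C \<nu> k \<zeta>) = (\<Sum>k\<in>S. c' k *\<^sub>C \<nu> (g \<otimes> k) \<zeta>)" if "g \<in> S" for g \<zeta>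
  proof -
    have g: "g \<in> carrier G" using that S by auto
    interpret l: Vector_Spaces.linear scaleC scaleC "\<nu> g" by (rule rep_linear[OF g])
    show ?thesis using g S by (auto simp: l.sum l.scale rep_mult subset_iff intro!: sum.cong)
  qed
  have "pi0 G \<nu> (a \<circ> b) \<zeta> = pi0 G \<nu> a (pi0 G \<nu> b \<zeta>)" for \<zeta>
  proof -
    have "pi0 G \<nu> (a \<circ> b) \<zeta> =
          (\<Sum>p\<in>S \<times> S. (c (fst p) * c' (snd p)) *\<^sub>C \<nu> (fst p \<otimes> snd p) \<zeta>)"
      unfolding S(4,5) lambda_sum_comp_image[OF S(1,2,1,2)]
      by (rule pi0_image) (use S im in auto)
    also have "\<dots> = (\<Sum>g\<in>S. c g *\<^sub>C \<nu> g (\<Sum>k\<in>S. c' k *\<^sub>C \<nu> k \<zeta>))"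
      by (simp add: lin complex_vector.scale_sum_right sum.cartesian_product case_prod_unfold)
    also have "\<dots> = pi0 G \<nu> a (pi0 G \<nu> b \<zeta>)"
      using S by (simp add: pi0_lambda_sum)
    finally show ?thesis .
  qed
  then show "pi0 G \<nu> (a \<circ> b) = pi0 G \<nu> a \<circ> pi0 G \<nu> b" by auto
next
  fix a b \<zeta> \<eta>
  assume "a \<in> group_algebra G" "b \<in> group_algebra G" and adj: "l2_adjoint G a b"
  then obtain S c c' where S: "finite S" "S \<subseteq> carrier G" "\<And>g. g \<in> S \<Longrightarrow> inv g \<in> S"
    "a = lambda_sum G S c" "b = lambda_sum G S c'"
    using group_algebra_common by metis
  have SG: "g \<in> carrier G" if "g \<in> S" for g using S that by auto
  have c': "c' k = cnj (c (inv k))" if "k \<in> S" for k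
    by (rule adjoint_coeff[OF S(1-3) _ that]) (use adj S in auto)
  have bij: "bij_betw (m_inv G) S S"
    by (rule bij_betwI[where g = "m_inv G"]) (use S SG in auto)
  have "cinner (pi0 G \<nu> a \<zeta>) \<eta> = (\<Sum>g\<in>S. c g * cinner \<zeta> (\<nu> (inv g) \<eta>))"
    using S SG by (simp add: pi0_lambda_sum cinner_sum_left cinner_scaleC_left rep_adjoint)
  also have "\<dots> = (\<Sum>g\<in>S. c (inv g) * cinner \<zeta> (\<nu> (inv (inv g)) \<eta>))"
    by (rule sum.reindex_bij_betw[OF bij, symmetric])
  also have "\<dots> = cinner \<zeta> (pi0 G \<nu> b \<eta>)"
    using S SG by (simp add: pi0_lambda_sum cinner_sum_right cinner_scaleC_right c')
  finally show "cinner (pi0 G \<nu> a \<zeta>) \<eta> = cinner \<zeta> (pi0 G \<nu> b \<eta>)" .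
qed

theorem star_representation_unique:
  assumes \<pi>: "star_representation G \<pi>" "\<And>g. g \<in> carrier G \<Longrightarrow> \<pi> (left_regular G g) = \<nu> g"
    and a: "a \<in> group_algebra G"
  shows "\<pi> a = pi0 G \<nu> a"
proof -
  have gen: "left_regular G g \<in> group_algebra G" if "g \<in> carrier G" for g
    using lambda_sum_in[of "{g}" "\<lambda>_. 1"] that by (simp add: lambda_sum_single)
  have add: "\<pi> (\<lambda>x h. a x h + b x h) = (\<lambda>\<zeta>. \<pi> a \<zeta> + \<pi> b \<zeta>)"
    if "a \<in> group_algebra G" "b \<in> group_algebra G" for a b
    using \<pi>(1) that by (auto simp: star_representation_def)
  have scale: "\<pi> (\<lambda>x h. z * a x h) = (\<lambda>\<zeta>. z *\<^sub>C \<pi> a \<zeta>)" if "a \<in> group_algebra G" for a z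
    using \<pi>(1) that by (auto simp: star_representation_def)
  have "\<pi> (lambda_sum G F c) = (\<lambda>\<zeta>. \<Sum>g\<in>F. c g *\<^sub>C \<nu> g \<zeta>)"
    if "finite F" "F \<subseteq> carrier G" for F c
    using that
  proof (induction F rule: finite_induct)
    case empty
    show ?case
      using scale[OF gen[OF one_closed], of 0] by (simp add: lambda_sum_def)
  next
    case (insert g F)
    have g: "g \<in> carrier G" using insert by auto
    have single: "(\<lambda>x h. c g * left_regular G g x h) \<in> group_algebra G"
      using lambda_sum_in[of "{g}" "\<lambda>_. c g"] g by (simp add: lambda_sum_def)
    have "lambda_sum G (insert g F) c =
          (\<lambda>x h. c g * left_regular G g x h + lambda_sum G F c x h)"
      using insert by (simp add: lambda_sum_def)
    then show ?case
      using insert g by (simp add: add[OF single lambda_sum_in] scale[OF gen] \<pi>(2))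
  qed
  moreover obtain F c where "finite F" "F \<subseteq> carrier G" "a = lambda_sum G F c"
    using a by (rule group_algebraE)
  ultimately show ?thesis by (auto simp: pi0_lambda_sum)
qed

end

text \<open>Linear subspaces invariant under the group algebra; these are also the submodules, as the
  algebra is unital over the complex numbers.\<close>

definition invariant_subspace ::
    "('g, 'm) monoid_scheme \<Rightarrow> ('g \<Rightarrow> 'h::complex_hilbert_space \<Rightarrow> 'h) \<Rightarrow> 'h set \<Rightarrow> bool"
  where "invariant_subspace G \<nu> S \<longleftrightarrow>
    complex_vector.subspace S \<and> (\<forall>a\<in>group_algebra G. pi0 G \<nu> a ` S \<subseteq> S)"

text \<open>The support condition only removes zero summands. The sum is meant for pairs for which the
  support is finite.\<close>

definition algebra_form ::
    "('g, 'm) monoid_scheme \<Rightarrow> ('g \<Rightarrow> 'h::complex_hilbert_space \<Rightarrow> 'h) \<Rightarrow> 'h \<Rightarrow> 'h \<Rightarrow>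
     ('g \<Rightarrow> complex) \<Rightarrow> ('g \<Rightarrow> complex)"
  where "algebra_form G \<nu> \<zeta> \<eta> =
    lambda_sum G {g \<in> carrier G. cinner \<zeta> (\<nu> g \<eta>) \<noteq> 0} (\<lambda>g. cinner \<zeta> (\<nu> g \<eta>))"

definition dual_module_frames ::
    "('g, 'm) monoid_scheme \<Rightarrow> ('g \<Rightarrow> 'h::complex_hilbert_space \<Rightarrow> 'h) \<Rightarrow> 'h set \<Rightarrow> nat \<Rightarrow>
     (nat \<Rightarrow> 'h) \<Rightarrow> (nat \<Rightarrow> 'h) \<Rightarrow> bool"
  where "dual_module_frames G \<nu> E d \<xi> \<xi>' \<longleftrightarrow>
    (\<forall>\<zeta>\<in>E. \<forall>\<eta>\<in>E. algebra_form G \<nu> \<zeta> \<eta> =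
       (\<lambda>x h. \<Sum>i\<in>{1..d}. (algebra_form G \<nu> \<zeta> (\<xi> i) \<circ> algebra_form G \<nu> (\<xi>' i) \<eta>) x h))"

text \<open>Summability is part of the upper frame bound: \<open>infsum\<close> of a divergent family is \<open>0\<close>.\<close>

definition frame_for :: "'h::complex_hilbert_space set \<Rightarrow> 'i set \<Rightarrow> ('i \<Rightarrow> 'h) \<Rightarrow> bool"
  where "frame_for K I \<xi> \<longleftrightarrow>
    countable I \<and> (\<forall>i\<in>I. \<xi> i \<in> K) \<and>
    (\<exists>A>0. \<exists>B>0. \<forall>\<zeta>\<in>K.
       (\<lambda>i. (cmod (cinner \<zeta> (\<xi> i)))\<^sup>2) summable_on I \<and>
       A * (norm \<zeta>)\<^sup>2 \<le> (\<Sum>\<^sub>\<infinity>i\<in>I. (cmod (cinner \<zeta> (\<xi> i)))\<^sup>2) \<and>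
       (\<Sum>\<^sub>\<infinity>i\<in>I. (cmod (cinner \<zeta> (\<xi> i)))\<^sup>2) \<le> B * (norm \<zeta>)\<^sup>2)"

definition dual_frames ::
    "'h::complex_hilbert_space set \<Rightarrow> 'i set \<Rightarrow> ('i \<Rightarrow> 'h) \<Rightarrow> ('i \<Rightarrow> 'h) \<Rightarrow> bool"
  where "dual_frames K I \<xi> \<xi>' \<longleftrightarrow>
    frame_for K I \<xi> \<and> frame_for K I \<xi>' \<and>
    (\<forall>\<zeta>\<in>K. ((\<lambda>i. cinner \<zeta> (\<xi> i) *\<^sub>C \<xi>' i) has_sum \<zeta>) I \<and>
            ((\<lambda>i. cinner \<zeta> (\<xi>' i) *\<^sub>C \<xi> i) has_sum \<zeta>) I)"

definition dual_G_frames ::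
    "('g, 'm) monoid_scheme \<Rightarrow> ('g \<Rightarrow> 'h::complex_hilbert_space \<Rightarrow> 'h) \<Rightarrow> 'h set \<Rightarrow> nat \<Rightarrow>
     (nat \<Rightarrow> 'h) \<Rightarrow> (nat \<Rightarrow> 'h) \<Rightarrow> bool"
  where "dual_G_frames G \<nu> K d \<xi> \<xi>' \<longleftrightarrow>
    dual_frames K (carrier G \<times> {1..d}) (\<lambda>(g, i). \<nu> g (\<xi> i)) (\<lambda>(g, i). \<nu> g (\<xi>' i))"

end

theory Submission
  imports Defs
begin

text \<open>
  Both conditions say that $\langle\zeta,\eta\rangle = \sum_{(g,i)}
  \langle\zeta,\nu_g\zeta_i\rangle\langle\nu_g\tilde\zeta_i,\eta\rangle$ for all
  $\zeta,\eta\in E$, a finite sum, called weak duality below.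

  For module frames this is a comparison of coefficients. An element of the group algebra is
  determined by its value at $\delta_1$, and the coefficient at $k$ of the module identity for
  $(\zeta,\eta)$ is weak duality for $(\zeta,\nu_k\eta)$; as $E$ is invariant, nothing is gained by
  $k\neq 1$ (\<open>dual_module_frames_iff_weak_duality\<close>).

  For Hilbert space frames, weak duality follows by pairing the reconstruction formula with $\eta$.
  Conversely, if $\zeta\in E$ then the reconstruction sum is finite, so it lies in $E$ and so does
  its difference from $\zeta$; by weak duality this difference is orthogonal to itself and thus
  vanishes. The step from $E$ to its closure, and the frame inequalities, need a
  Bessel bound. It comes from the support condition alone: the Gram matrix of an orbit family depends
  only on $g^{-1}h$ and on finitely many indices, and each of its rows has a finite number of nonzero
  entries, so the absolute row sums are uniformly bounded and the Schur test applies
  (\<open>orbit_synthesis_bound\<close>). With Bessel bounds for both families the partial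
  reconstruction operators are uniformly bounded, hence converge on the closure of $E$, and the
  Bessel bound of one family gives the lower frame bound of the other
  (\<open>dual_frames_iff_weak_duality\<close>).
\<close>

section \<open>Inner products\<close>

lemma cinner_diff_left:
  "cinner (x - y) (z :: 'h::complex_hilbert_space) = cinner x z - cinner y z"
  using cinner_add_left[of "x - y" y z] by simp

lemma cinner_diff_right:
  "cinner (z :: 'h::complex_hilbert_space) (x - y) = cinner z x - cinner z y"
  using cinner_add_right[of z "x - y" y] by simp

lemma cinner_self: "cinner x x = complex_of_real ((norm (x :: 'h::complex_hilbert_space))\<^sup>2)"
proof -
  have "cinner x x = cnj (cinner x x)" by (rule cinner_commute)
  then have "Im (cinner x x) = 0" by (simp add: complex_eq_iff)
  then show ?thesis
    using cinner_ge_zero[of x] by (simp add: complex_eq_iff norm_eq_sqrt_cinner[of x])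
qed

lemma cinner_Cauchy_Schwarz:
  "cmod (cinner x y) \<le> norm x * norm (y :: 'h::complex_hilbert_space)"
proof (cases "y = 0")
  case True
  have "cinner x (0 :: 'h) = 0" by (subst cinner_commute) (simp add: cinner_zero_left)
  then show ?thesis using True by simp
next
  case False
  define c where "c = cinner x y / complex_of_real ((norm y)\<^sup>2)"
  have ny: "(norm y)\<^sup>2 > 0" using False by simp
  have yx: "cinner y x = cnj (cinner x y)" by (rule cinner_commute)
  \<comment> \<open>\<open>c\<close> makes \<open>c *\<^sub>C y\<close> the orthogonal projection of \<open>x\<close> to the line of \<open>y\<close>.\<close>
  have "complex_of_real ((norm (x - c *\<^sub>C y))\<^sup>2) =
      cinner x x - cnj c * cinner x y - c * cinner y x + c * cnj c * cinner y y"
    by (simp add: cinner_self[symmetric] cinner_diff_left cinner_diff_right cinner_scaleC_left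
        cinner_scaleC_right algebra_simps del: of_real_power)
  also have "\<dots> = cinner x x - cinner x y * cnj (cinner x y) / complex_of_real ((norm y)\<^sup>2)"
    using ny unfolding c_def yx cinner_self[of y] by (simp add: field_simps)
  also have "\<dots> = complex_of_real ((norm x)\<^sup>2 - (cmod (cinner x y))\<^sup>2 / (norm y)\<^sup>2)"
    by (simp add: cinner_self[of x] complex_norm_square[symmetric])
  finally have "(norm (x - c *\<^sub>C y))\<^sup>2 = (norm x)\<^sup>2 - (cmod (cinner x y))\<^sup>2 / (norm y)\<^sup>2"
    unfolding of_real_eq_iff .
  then have "(cmod (cinner x y))\<^sup>2 / (norm y)\<^sup>2 \<le> (norm x)\<^sup>2"
    by (metis diff_ge_0_iff_ge zero_le_power2)
  then have "(cmod (cinner x y))\<^sup>2 \<le> (norm x * norm y)\<^sup>2"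
    using ny by (simp add: divide_le_eq power_mult_distrib)
  then show ?thesis by (rule power2_le_imp_le) simp
qed

lemma bounded_linear_cinner_left:
  "bounded_linear (\<lambda>x. cinner x (y :: 'h::complex_hilbert_space))"
proof (rule bounded_linear_intro[where K = "norm y"])
  show "cinner (r *\<^sub>R x) y = r *\<^sub>R cinner x y" for r and x :: 'h
    by (simp add: scaleR_scaleC cinner_scaleC_left scaleR_conv_of_real scaleC_complex_def)
qed (auto simp: cinner_add_left cinner_Cauchy_Schwarz)

section \<open>Bessel families and dual frames\<close>

text \<open>The Bessel property, put as a bound on the synthesis operator instead of the
  analysis operator: in this form it concerns finite combinations only, and it is what the Schur
  test yields and what controls the partial sums of a reconstruction.\<close>

definition synthesis_bound :: "'i set \<Rightarrow> ('i \<Rightarrow> 'h::complex_hilbert_space) \<Rightarrow> real \<Rightarrow> bool"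
  where "synthesis_bound I \<xi> B \<longleftrightarrow>
    (\<forall>F c. finite F \<longrightarrow> F \<subseteq> I \<longrightarrow>
       (norm (\<Sum>p\<in>F. c p *\<^sub>C \<xi> p))\<^sup>2 \<le> B * (\<Sum>p\<in>F. (cmod (c p))\<^sup>2))"

lemma synthesis_boundD:
  assumes "synthesis_bound I \<xi> B" "finite F" "F \<subseteq> I"
  shows "(norm (\<Sum>p\<in>F. c p *\<^sub>C \<xi> p))\<^sup>2 \<le> B * (\<Sum>p\<in>F. (cmod (c p))\<^sup>2)"
  using assms by (simp add: synthesis_bound_def)

text \<open>The Schur test for the Gram matrix: after expanding the square of the norm, each
  product of two coefficients is at most the mean of their squares, and by symmetry of the matrix the
  two halves have the same sum.\<close>

lemma synthesis_bound_of_Gram_rows: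
  fixes \<xi> :: "'i \<Rightarrow> 'h::complex_hilbert_space"
  assumes rows: "\<And>F p. finite F \<Longrightarrow> F \<subseteq> I \<Longrightarrow> p \<in> I \<Longrightarrow>
    (\<Sum>q\<in>F. cmod (cinner (\<xi> p) (\<xi> q))) \<le> M"
  shows "synthesis_bound I \<xi> M"
  unfolding synthesis_bound_def
proof (intro allI impI)
  fix F and c :: "'i \<Rightarrow> complex" assume F: "finite F" "F \<subseteq> I"
  define s where "s = (\<Sum>p\<in>F. c p *\<^sub>C \<xi> p)"
  define \<gamma> where "\<gamma> p q = cmod (cinner (\<xi> p) (\<xi> q))" for p q
  have sym: "\<gamma> p q = \<gamma> q p" for p q
    unfolding \<gamma>_def by (subst cinner_commute) simp
  have "complex_of_real ((norm s)\<^sup>2) =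
      (\<Sum>p\<in>F. \<Sum>q\<in>F. c p * (cnj (c q) * cinner (\<xi> p) (\<xi> q)))"
    unfolding cinner_self[symmetric] s_def cinner_sum_left
    by (simp add: cinner_sum_right cinner_scaleC_left cinner_scaleC_right sum_distrib_left mult.left_commute)
  then have "(norm s)\<^sup>2 = cmod (\<Sum>p\<in>F. \<Sum>q\<in>F. c p * (cnj (c q) * cinner (\<xi> p) (\<xi> q)))"
    by (metis abs_of_nonneg norm_of_real zero_le_power2)
  also have "\<dots> \<le> (\<Sum>p\<in>F. \<Sum>q\<in>F. (cmod (c p))\<^sup>2 / 2 * \<gamma> p q + (cmod (c q))\<^sup>2 / 2 * \<gamma> q p)"
  proof (intro sum_norm_le)
    fix p q
    have "cmod (c p) * cmod (c q) * \<gamma> p q \<le> ((cmod (c p))\<^sup>2 / 2 + (cmod (c q))\<^sup>2 / 2) * \<gamma> p q"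
      using sum_squares_bound[of "cmod (c p)" "cmod (c q)"]
      by (intro mult_right_mono) (auto simp: \<gamma>_def)
    then show "cmod (c p * (cnj (c q) * cinner (\<xi> p) (\<xi> q))) \<le>
        (cmod (c p))\<^sup>2 / 2 * \<gamma> p q + (cmod (c q))\<^sup>2 / 2 * \<gamma> q p"
      unfolding sym[of q p] by (simp add: norm_mult \<gamma>_def algebra_simps)
  qed
  also have "\<dots> = (\<Sum>p\<in>F. \<Sum>q\<in>F. (cmod (c p))\<^sup>2 / 2 * \<gamma> p q) +
      (\<Sum>p\<in>F. \<Sum>q\<in>F. (cmod (c q))\<^sup>2 / 2 * \<gamma> q p)"
    by (simp add: sum.distrib)
  also have "(\<Sum>p\<in>F. \<Sum>q\<in>F. (cmod (c q))\<^sup>2 / 2 * \<gamma> q p) =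
      (\<Sum>p\<in>F. \<Sum>q\<in>F. (cmod (c p))\<^sup>2 / 2 * \<gamma> p q)"
    by (rule sum.swap)
  also have "(\<Sum>p\<in>F. \<Sum>q\<in>F. (cmod (c p))\<^sup>2 / 2 * \<gamma> p q) + \<dots> =
      (\<Sum>p\<in>F. (cmod (c p))\<^sup>2 * (\<Sum>q\<in>F. \<gamma> p q))"
    by (simp add: sum.distrib[symmetric] sum_distrib_left mult.commute[of "\<gamma> _ _"])
  also have "\<dots> \<le> (\<Sum>p\<in>F. (cmod (c p))\<^sup>2 * M)"
    using rows[OF F] F by (intro sum_mono mult_left_mono) (auto simp: \<gamma>_def)
  finally show "(norm (\<Sum>p\<in>F. c p *\<^sub>C \<xi> p))\<^sup>2 \<le> M * (\<Sum>p\<in>F. (cmod (c p))\<^sup>2)"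
    by (simp add: s_def sum_distrib_left mult.commute)
qed

text \<open>The analysis operator is the adjoint of the synthesis operator, so it has the same bound.
  Concretely, the sum \<open>T\<close> on the left is the inner product of \<open>\<zeta>\<close> with the vector that is synthesized
  from the coefficients of \<open>\<zeta>\<close>, whose squared norm is at most \<open>B * T\<close>.\<close>

lemma synthesis_bound_analysis:
  assumes B: "synthesis_bound I \<xi> B" "B \<ge> 0" and F: "finite F" "F \<subseteq> I"
  shows "(\<Sum>p\<in>F. (cmod (cinner \<zeta> (\<xi> p)))\<^sup>2) \<le> B * (norm \<zeta>)\<^sup>2"
proof -
  define T where "T = (\<Sum>p\<in>F. (cmod (cinner \<zeta> (\<xi> p)))\<^sup>2)"
  define s where "s = (\<Sum>p\<in>F. cinner \<zeta> (\<xi> p) *\<^sub>C \<xi> p)"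
  have T0: "T \<ge> 0" by (simp add: T_def sum_nonneg)
  have "cinner \<zeta> s = complex_of_real T"
    by (simp add: s_def T_def cinner_sum_right cinner_scaleC_right complex_norm_square mult.commute
        del: of_real_power)
  then have "T \<le> norm \<zeta> * norm s"
    using cinner_Cauchy_Schwarz[of \<zeta> s] T0 by simp
  then have "T\<^sup>2 \<le> (norm \<zeta>)\<^sup>2 * (norm s)\<^sup>2"
    using T0 by (metis power_mono power_mult_distrib)
  also have "\<dots> \<le> (norm \<zeta>)\<^sup>2 * (B * T)"
    unfolding s_def T_def by (intro mult_left_mono synthesis_boundD[OF B(1) F]) simp
  finally have "T * T \<le> (B * (norm \<zeta>)\<^sup>2) * T"
    by (simp add: power2_eq_square mult_ac)
  then have "T \<le> B * (norm \<zeta>)\<^sup>2"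
    using T0 B(2) by (cases "T = 0") (auto simp: mult_le_cancel_right)
  then show ?thesis by (simp add: T_def)
qed

lemma synthesis_bound_summable:
  assumes "synthesis_bound I \<xi> B" "B \<ge> 0"
  shows "(\<lambda>p. (cmod (cinner \<zeta> (\<xi> p)))\<^sup>2) summable_on I"
  using synthesis_bound_analysis[OF assms]
  by (intro nonneg_bdd_above_summable_on bdd_aboveI[where M = "B * (norm \<zeta>)\<^sup>2"]) auto

lemma synthesis_bound_infsum:
  assumes "synthesis_bound I \<xi> B" "B \<ge> 0"
  shows "(\<Sum>\<^sub>\<infinity>p\<in>I. (cmod (cinner \<zeta> (\<xi> p)))\<^sup>2) \<le> B * (norm \<zeta>)\<^sup>2"
  using synthesis_bound_summable[OF assms] synthesis_bound_analysis[OF assms]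
  by (rule infsum_le_finite_sums)

text \<open>A vector synthesized from its own coefficients cannot be large when these are
  small: an upper bound for \<open>\<xi>'\<close> is a lower frame bound for \<open>\<xi>\<close>.\<close>

lemma reconstruction_lower_bound:
  assumes \<xi>: "(\<lambda>p. (cmod (cinner \<zeta> (\<xi> p)))\<^sup>2) summable_on I"
    and B: "synthesis_bound I \<xi>' B" "B \<ge> 0"
    and rec: "((\<lambda>p. cinner \<zeta> (\<xi> p) *\<^sub>C \<xi>' p) has_sum \<zeta>) I"
  shows "(norm \<zeta>)\<^sup>2 \<le> B * (\<Sum>\<^sub>\<infinity>p\<in>I. (cmod (cinner \<zeta> (\<xi> p)))\<^sup>2)"
proof -
  have lim: "((\<lambda>F. (norm (\<Sum>p\<in>F. cinner \<zeta> (\<xi> p) *\<^sub>C \<xi>' p))\<^sup>2) \<longlongrightarrow> (norm \<zeta>)\<^sup>2)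
      (finite_subsets_at_top I)"
    using rec unfolding has_sum_def by (intro tendsto_intros)
  have bound: "(norm (\<Sum>p\<in>F. cinner \<zeta> (\<xi> p) *\<^sub>C \<xi>' p))\<^sup>2 \<le>
      B * (\<Sum>\<^sub>\<infinity>p\<in>I. (cmod (cinner \<zeta> (\<xi> p)))\<^sup>2)" if F: "finite F" "F \<subseteq> I" for F
  proof -
    have "(norm (\<Sum>p\<in>F. cinner \<zeta> (\<xi> p) *\<^sub>C \<xi>' p))\<^sup>2 \<le> B * (\<Sum>p\<in>F. (cmod (cinner \<zeta> (\<xi> p)))\<^sup>2)"
      by (rule synthesis_boundD[OF B(1) F])
    also have "\<dots> \<le> B * (\<Sum>\<^sub>\<infinity>p\<in>I. (cmod (cinner \<zeta> (\<xi> p)))\<^sup>2)"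
      using \<xi> B F by (intro mult_left_mono finite_sum_le_infsum) auto
    finally show ?thesis .
  qed
  have "\<forall>\<^sub>F F in finite_subsets_at_top I. (norm (\<Sum>p\<in>F. cinner \<zeta> (\<xi> p) *\<^sub>C \<xi>' p))\<^sup>2 \<le>
      B * (\<Sum>\<^sub>\<infinity>p\<in>I. (cmod (cinner \<zeta> (\<xi> p)))\<^sup>2)"
    using bound by (rule eventually_finite_subsets_at_top_weakI)
  with lim show ?thesis
    by (rule tendsto_upperbound) (rule finite_subsets_at_top_neq_bot)
qed

text \<open>The partial sums are linear in the vector and bounded by one constant \<open>K\<close>, independent of
  the finite index set, so the set of vectors where they converge to that vector is closed.\<close>

lemma reconstruction_on_closure:
  fixes \<xi> \<xi>' :: "'i \<Rightarrow> 'h::complex_hilbert_space"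
  assumes B: "synthesis_bound I \<xi> B" "B \<ge> 0" and B': "synthesis_bound I \<xi>' B'" "B' \<ge> 0"
    and rec: "\<And>\<eta>. \<eta> \<in> E \<Longrightarrow> ((\<lambda>p. cinner \<eta> (\<xi> p) *\<^sub>C \<xi>' p) has_sum \<eta>) I"
    and \<zeta>: "\<zeta> \<in> closure E"
  shows "((\<lambda>p. cinner \<zeta> (\<xi> p) *\<^sub>C \<xi>' p) has_sum \<zeta>) I"
proof -
  define S where "S F \<eta> = (\<Sum>p\<in>F. cinner \<eta> (\<xi> p) *\<^sub>C \<xi>' p)" for F \<eta>
  define K where "K = sqrt (B' * B)"
  have K: "K \<ge> 0" using B B' by (simp add: K_def)
  have S_diff: "S F (\<eta> - \<theta>) = S F \<eta> - S F \<theta>" for F \<eta> \<theta>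
    by (simp add: S_def cinner_diff_left complex_vector.scale_left_diff_distrib sum_subtractf)
  have S_bound: "norm (S F \<eta>) \<le> K * norm \<eta>" if F: "finite F" "F \<subseteq> I" for F \<eta>
  proof -
    have "(norm (S F \<eta>))\<^sup>2 \<le> B' * (\<Sum>p\<in>F. (cmod (cinner \<eta> (\<xi> p)))\<^sup>2)"
      unfolding S_def by (rule synthesis_boundD[OF B'(1) F])
    also have "\<dots> \<le> B' * (B * (norm \<eta>)\<^sup>2)"
      by (intro mult_left_mono synthesis_bound_analysis[OF B F] B')
    also have "\<dots> = (K * norm \<eta>)\<^sup>2"
      using B B' by (simp add: K_def power_mult_distrib)
    finally show ?thesis by (rule power2_le_imp_le) (simp add: K)
  qed
  have "\<forall>\<^sub>F F in finite_subsets_at_top I. dist (S F \<zeta>) \<zeta> < \<epsilon>" if "\<epsilon> > 0" for \<epsilon>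
  proof -
    define \<delta> where "\<delta> = \<epsilon> / (K + 2)"
    have \<delta>: "\<delta> > 0" "(K + 2) * \<delta> = \<epsilon>" using that K by (auto simp: \<delta>_def)
    \<comment> \<open>The error is at most \<open>K * \<delta> + \<delta> + \<delta>\<close>: the partial sum of the perturbation, the
      error at \<open>\<eta>\<close>, and the perturbation itself.\<close>
    obtain \<eta> where \<eta>: "\<eta> \<in> E" "dist \<eta> \<zeta> < \<delta>"
      using \<zeta> \<delta>(1) unfolding closure_approachable by blast
    have "\<forall>\<^sub>F F in finite_subsets_at_top I. dist (S F \<eta>) \<eta> < \<delta>"
      using rec[OF \<eta>(1)] \<delta>(1) unfolding has_sum_def S_def by (rule tendstoD)
    moreover have "\<forall>\<^sub>F F in finite_subsets_at_top I. finite F \<and> F \<subseteq> I"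
      by (rule eventually_finite_subsets_at_top_weakI) simp
    ultimately show ?thesis
    proof eventually_elim
      case (elim F)
      have "norm (S F (\<zeta> - \<eta>)) \<le> K * \<delta>"
      proof -
        have "norm (S F (\<zeta> - \<eta>)) \<le> K * norm (\<zeta> - \<eta>)" using elim by (intro S_bound) auto
        also have "\<dots> \<le> K * \<delta>"
          using \<eta>(2) K by (intro mult_left_mono) (auto simp: dist_norm norm_minus_commute)
        finally show ?thesis .
      qed
      then have "dist (S F \<zeta>) (S F \<eta>) \<le> K * \<delta>" by (simp add: dist_norm S_diff)
      moreover have "dist (S F \<zeta>) \<zeta> \<le> dist (S F \<zeta>) (S F \<eta>) + dist (S F \<eta>) \<eta> + dist \<eta> \<zeta>"
        by (meson add_right_mono dist_triangle order_trans)
      ultimately have "dist (S F \<zeta>) \<zeta> < (K + 2) * \<delta>"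
        using elim \<eta>(2) by (simp add: algebra_simps)
      then show ?case by (simp add: \<delta>(2))
    qed
  qed
  then show ?thesis unfolding has_sum_def S_def by (intro tendstoI)
qed

lemma frame_for_of_reconstruction:
  assumes "countable I" and \<xi>: "\<And>p. p \<in> I \<Longrightarrow> \<xi> p \<in> K"
    and B: "synthesis_bound I \<xi> B" "B > 0" and B': "synthesis_bound I \<xi>' B'" "B' > 0"
    and rec: "\<And>\<zeta>. \<zeta> \<in> K \<Longrightarrow> ((\<lambda>p. cinner \<zeta> (\<xi> p) *\<^sub>C \<xi>' p) has_sum \<zeta>) I"
  shows "frame_for K I \<xi>"
proof -
  have bounds: "(\<lambda>p. (cmod (cinner \<zeta> (\<xi> p)))\<^sup>2) summable_on I \<and>
      1 / B' * (norm \<zeta>)\<^sup>2 \<le> (\<Sum>\<^sub>\<infinity>p\<in>I. (cmod (cinner \<zeta> (\<xi> p)))\<^sup>2) \<and>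
      (\<Sum>\<^sub>\<infinity>p\<in>I. (cmod (cinner \<zeta> (\<xi> p)))\<^sup>2) \<le> B * (norm \<zeta>)\<^sup>2" if \<zeta>: "\<zeta> \<in> K" for \<zeta>
  proof (intro conjI)
    show sm: "(\<lambda>p. (cmod (cinner \<zeta> (\<xi> p)))\<^sup>2) summable_on I"
      using B by (intro synthesis_bound_summable) auto
    show "(\<Sum>\<^sub>\<infinity>p\<in>I. (cmod (cinner \<zeta> (\<xi> p)))\<^sup>2) \<le> B * (norm \<zeta>)\<^sup>2"
      using B by (intro synthesis_bound_infsum) auto
    show "1 / B' * (norm \<zeta>)\<^sup>2 \<le> (\<Sum>\<^sub>\<infinity>p\<in>I. (cmod (cinner \<zeta> (\<xi> p)))\<^sup>2)"
      using reconstruction_lower_bound[OF sm B'(1) _ rec[OF \<zeta>]] B'(2)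
      by (simp add: field_simps)
  qed
  have "1 / B' > 0" using B'(2) by simp
  then show ?thesis
    unfolding frame_for_def using assms(1) \<xi> B(2) bounds by blast
qed

lemma has_sum_finite_support:
  assumes "finite J" "J \<subseteq> I" "\<And>p. p \<in> I - J \<Longrightarrow> f p = 0"
  shows "(f has_sum sum f J) I"
proof -
  have "(f has_sum sum f J) J \<longleftrightarrow> (f has_sum sum f J) I"
    using assms(2,3) by (intro has_sum_cong_neutral) blast+
  then show ?thesis using has_sum_finite[OF assms(1)] by blast
qed

definition weak_duality ::
    "'h::complex_hilbert_space set \<Rightarrow> 'i set \<Rightarrow> ('i \<Rightarrow> 'h) \<Rightarrow> ('i \<Rightarrow> 'h) \<Rightarrow> bool"
  where "weak_duality E I \<xi> \<xi>' \<longleftrightarrow> (\<forall>\<zeta>\<in>E. \<forall>\<eta>\<in>E.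
    ((\<lambda>p. cinner \<zeta> (\<xi> p) * cinner (\<xi>' p) \<eta>) has_sum cinner \<zeta> \<eta>) I)"

text \<open>Reconstruction is not symmetric in the two families on its face; weak duality is, by complex
  conjugation. This is why one module identity gives both reconstruction formulas.\<close>

lemma weak_duality_sym:
  assumes "weak_duality E I \<xi> \<xi>'"
  shows "weak_duality E I \<xi>' \<xi>"
  unfolding weak_duality_def
proof (intro ballI)
  fix \<zeta> \<eta> assume "\<zeta> \<in> E" "\<eta> \<in> E"
  then have "((\<lambda>p. cinner \<eta> (\<xi> p) * cinner (\<xi>' p) \<zeta>) has_sum cinner \<eta> \<zeta>) I"
    using assms unfolding weak_duality_def by blast
  then have "((\<lambda>p. cnj (cinner \<eta> (\<xi> p) * cinner (\<xi>' p) \<zeta>)) has_sum cnj (cinner \<eta> \<zeta>)) I"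
    unfolding has_sum_cnj_iff .
  then show "((\<lambda>p. cinner \<zeta> (\<xi>' p) * cinner (\<xi> p) \<eta>) has_sum cinner \<zeta> \<eta>) I"
    by (simp only: complex_cnj_mult cinner_commute[symmetric] mult.commute)
qed

text \<open>Weak duality only tests against vectors of \<open>E\<close>. By finiteness of the support the reconstruction
  sum \<open>s\<close> is itself in \<open>E\<close>, so \<open>\<zeta> - s\<close> is an admissible test vector, and testing with
  it shows that it is orthogonal to itself.\<close>

lemma reconstruction_of_weak_duality:
  fixes E :: "'h::complex_hilbert_space set"
  assumes wd: "weak_duality E I \<xi> \<xi>'" and E: "complex_vector.subspace E"
    and \<xi>': "\<And>p. p \<in> I \<Longrightarrow> \<xi>' p \<in> E"
    and fin: "\<And>\<zeta>. \<zeta> \<in> E \<Longrightarrow> finite {p \<in> I. cinner \<zeta> (\<xi> p) \<noteq> 0}"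
    and \<zeta>: "\<zeta> \<in> E"
  shows "((\<lambda>p. cinner \<zeta> (\<xi> p) *\<^sub>C \<xi>' p) has_sum \<zeta>) I"
proof -
  define J where "J = {p \<in> I. cinner \<zeta> (\<xi> p) \<noteq> 0}"
  define s where "s = (\<Sum>p\<in>J. cinner \<zeta> (\<xi> p) *\<^sub>C \<xi>' p)"
  have J: "finite J" "J \<subseteq> I" using fin[OF \<zeta>] by (auto simp: J_def)
  have "s \<in> E"
    unfolding s_def using E J \<xi>'
    by (intro complex_vector.subspace_sum complex_vector.subspace_scale) auto
  then have r: "\<zeta> - s \<in> E" using E \<zeta> by (intro complex_vector.subspace_diff)
  have "((\<lambda>p. cinner \<zeta> (\<xi> p) * cinner (\<xi>' p) (\<zeta> - s)) has_sum
      (\<Sum>p\<in>J. cinner \<zeta> (\<xi> p) * cinner (\<xi>' p) (\<zeta> - s))) I"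
    using J by (rule has_sum_finite_support) (auto simp: J_def)
  then have "cinner \<zeta> (\<zeta> - s) = (\<Sum>p\<in>J. cinner \<zeta> (\<xi> p) * cinner (\<xi>' p) (\<zeta> - s))"
    using wd \<zeta> r unfolding weak_duality_def by (blast intro: has_sum_unique)
  also have "\<dots> = cinner s (\<zeta> - s)"
    by (simp add: s_def cinner_sum_left cinner_scaleC_left)
  finally have "cinner (\<zeta> - s) (\<zeta> - s) = 0" by (simp add: cinner_diff_left)
  then have "\<zeta> = s" by (simp add: cinner_eq_zero_iff)
  moreover have "((\<lambda>p. cinner \<zeta> (\<xi> p) *\<^sub>C \<xi>' p) has_sum s) I"
    unfolding s_def using J by (rule has_sum_finite_support) (auto simp: J_def)
  ultimately show ?thesis by simp
qed

text \<open>Pairing the reconstruction formula with vectors of \<open>E\<close> gives one direction. In the other,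
  finiteness of the supports gives reconstruction on \<open>E\<close>, the two Bessel bounds extend it to the
  closure, and each of them serves as the lower frame bound of the other family.\<close>

theorem dual_frames_iff_weak_duality:
  fixes E :: "'h::complex_hilbert_space set"
  assumes "countable I" and E: "complex_vector.subspace E"
    and \<xi>: "\<And>p. p \<in> I \<Longrightarrow> \<xi> p \<in> E" and \<xi>': "\<And>p. p \<in> I \<Longrightarrow> \<xi>' p \<in> E"
    and B: "synthesis_bound I \<xi> B" "B > 0" and B': "synthesis_bound I \<xi>' B'" "B' > 0"
    and fin: "\<And>\<zeta>. \<zeta> \<in> E \<Longrightarrow> finite {p \<in> I. cinner \<zeta> (\<xi> p) \<noteq> 0}"
    and fin': "\<And>\<zeta>. \<zeta> \<in> E \<Longrightarrow> finite {p \<in> I. cinner \<zeta> (\<xi>' p) \<noteq> 0}"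
  shows "dual_frames (closure E) I \<xi> \<xi>' \<longleftrightarrow> weak_duality E I \<xi> \<xi>'"
proof
  assume df: "dual_frames (closure E) I \<xi> \<xi>'"
  show "weak_duality E I \<xi> \<xi>'"
    unfolding weak_duality_def
  proof (intro ballI)
    fix \<zeta> \<eta> assume "\<zeta> \<in> E" "\<eta> \<in> E"
    then have "((\<lambda>p. cinner \<zeta> (\<xi> p) *\<^sub>C \<xi>' p) has_sum \<zeta>) I"
      using df closure_subset[of E] unfolding dual_frames_def by blast
    then have "((\<lambda>p. cinner (cinner \<zeta> (\<xi> p) *\<^sub>C \<xi>' p) \<eta>) has_sum cinner \<zeta> \<eta>) I"
      by (rule has_sum_bounded_linear[OF bounded_linear_cinner_left])
    then show "((\<lambda>p. cinner \<zeta> (\<xi> p) * cinner (\<xi>' p) \<eta>) has_sum cinner \<zeta> \<eta>) I"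
      by (simp add: cinner_scaleC_left)
  qed
next
  assume wd: "weak_duality E I \<xi> \<xi>'"
  have rec: "((\<lambda>p. cinner \<zeta> (\<xi> p) *\<^sub>C \<xi>' p) has_sum \<zeta>) I" if "\<zeta> \<in> closure E" for \<zeta>
    by (rule reconstruction_on_closure[OF B(1) less_imp_le[OF B(2)] B'(1) less_imp_le[OF B'(2)]
          reconstruction_of_weak_duality[OF wd E \<xi>' fin] that])
  have rec': "((\<lambda>p. cinner \<zeta> (\<xi>' p) *\<^sub>C \<xi> p) has_sum \<zeta>) I" if "\<zeta> \<in> closure E" for \<zeta>
    by (rule reconstruction_on_closure[OF B'(1) less_imp_le[OF B'(2)] B(1) less_imp_le[OF B(2)]
          reconstruction_of_weak_duality[OF weak_duality_sym[OF wd] E \<xi> fin'] that])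
  have "frame_for (closure E) I \<xi>"
    by (rule frame_for_of_reconstruction[OF assms(1) subsetD[OF closure_subset \<xi>] B B' rec])
  moreover have "frame_for (closure E) I \<xi>'"
    by (rule frame_for_of_reconstruction[OF assms(1) subsetD[OF closure_subset \<xi>'] B' B rec'])
  ultimately show "dual_frames (closure E) I \<xi> \<xi>'"
    using rec rec' unfolding dual_frames_def by blast
qed

section \<open>Coefficients in the group algebra\<close>

context group
begin

text \<open>The operators \<open>left_regular G g\<close> send the delta at the unit to the delta at \<open>g\<close>, so the value at this
  one vector is the coefficient function.\<close>

lemma group_algebra_eqI:
  assumes "a \<in> group_algebra G" "b \<in> group_algebra G"
    and eq: "\<And>k. k \<in> carrier G \<Longrightarrow> a (l2_delta \<one>) k = b (l2_delta \<one>) k"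
  shows "a = b"
proof -
  obtain S c c' where S: "finite S" "S \<subseteq> carrier G"
    "a = lambda_sum G S c" "b = lambda_sum G S c'"
    using group_algebra_common[OF assms(1,2)] by metis
  have "c k = c' k" if "k \<in> S" for k
    using eq[of k] that S by (auto simp: lambda_sum_coeff)
  then show ?thesis using S by (auto simp: lambda_sum_def fun_eq_iff intro!: sum.cong)
qed

lemma group_algebra_add:
  assumes "a \<in> group_algebra G" "b \<in> group_algebra G"
  shows "(\<lambda>x h. a x h + b x h) \<in> group_algebra G"
proof -
  obtain S c c' where S: "finite S" "S \<subseteq> carrier G"
    "a = lambda_sum G S c" "b = lambda_sum G S c'"
    using group_algebra_common[OF assms] by metis
  have "(\<lambda>x h. a x h + b x h) = lambda_sum G S (\<lambda>g. c g + c' g)"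
    by (simp add: S lambda_sum_def fun_eq_iff sum.distrib distrib_right)
  then show ?thesis using S by (simp add: lambda_sum_in)
qed

lemma group_algebra_sum:
  assumes "finite I" "\<And>i. i \<in> I \<Longrightarrow> a i \<in> group_algebra G"
  shows "(\<lambda>x h. \<Sum>i\<in>I. a i x h) \<in> group_algebra G"
  using assms
proof (induction I rule: finite_induct)
  case empty
  have "(\<lambda>x h. 0) = lambda_sum G {} (\<lambda>_. 0)" by (simp add: lambda_sum_def)
  then show ?case using lambda_sum_in[of "{}"] by simp
next
  case (insert i I)
  then show ?case by (simp add: group_algebra_add)
qed

lemma lambda_sum_apply:
  assumes "F \<subseteq> carrier G" "x \<in> l2 G" "k \<in> carrier G"
  shows "lambda_sum G F c x k = (\<Sum>g\<in>F. c g * x (inv g \<otimes> k))"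
  using assms by (simp add: lambda_sum_def left_regular_def)

end

section \<open>Module frames and frames of orbits\<close>

context unitary_representation
begin

lemma cinner_translates:
  assumes "g \<in> carrier G" "k \<in> carrier G"
  shows "cinner (\<nu> g \<zeta>) (\<nu> k \<eta>) = cinner \<zeta> (\<nu> (inv g \<otimes> k) \<eta>)"
  using assms by (simp add: rep_adjoint rep_mult)

lemma invariant_subspace_rep:
  assumes "invariant_subspace G \<nu> E" "g \<in> carrier G" "\<zeta> \<in> E"
  shows "\<nu> g \<zeta> \<in> E"
proof -
  have "left_regular G g \<in> group_algebra G"
    using lambda_sum_in[of "{g}" "\<lambda>_. 1"] assms by (simp add: lambda_sum_single)
  then have "pi0 G \<nu> (left_regular G g) \<zeta> \<in> E"
    using assms by (auto simp: invariant_subspace_def)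
  then show ?thesis using assms by (simp add: pi0_left_regular)
qed

lemma finite_orbit_support:
  fixes \<xi> :: "nat \<Rightarrow> 'h"
  assumes "\<And>i. i \<in> {1..d} \<Longrightarrow> finite {g \<in> carrier G. cinner \<zeta> (\<nu> g (\<xi> i)) \<noteq> 0}"
  shows "finite {p \<in> carrier G \<times> {1..d}. cinner \<zeta> ((\<lambda>(g, i). \<nu> g (\<xi> i)) p) \<noteq> 0}"
proof (rule finite_subset)
  show "finite ((\<Union>i\<in>{1..d}. {g \<in> carrier G. cinner \<zeta> (\<nu> g (\<xi> i)) \<noteq> 0}) \<times> {1..d})"
    using assms by auto
qed auto

text \<open>The Gram entry of \<open>(g, i)\<close> and \<open>(h, j)\<close> is the one of \<open>(\<one>, i)\<close> and
  \<open>(inv g \<otimes> h, j)\<close>. So translation by \<open>inv g\<close> turns each row into one of the \<open>d\<close>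
  rows that start at the unit, each with finite support \<open>S i\<close>, and \<open>M\<close>, the sum of all their
  entries, bounds every row. The bound is \<open>M + 1\<close> because \<open>M\<close> can be \<open>0\<close> and a frame
  bound has to be positive.\<close>

lemma orbit_synthesis_bound:
  fixes \<xi> :: "nat \<Rightarrow> 'h"
  assumes fin: "\<And>i j. i \<in> {1..d} \<Longrightarrow> j \<in> {1..d} \<Longrightarrow>
      finite {g \<in> carrier G. cinner (\<xi> i) (\<nu> g (\<xi> j)) \<noteq> 0}"
  obtains B where "B > 0" "synthesis_bound (carrier G \<times> {1..d}) (\<lambda>(g, i). \<nu> g (\<xi> i)) B"
proof -
  define \<phi> where "\<phi> i q = cmod (cinner (\<xi> i) ((\<lambda>(g, j). \<nu> g (\<xi> j)) q))" for i q
  define S where "S i = {q \<in> carrier G \<times> {1..d}. cinner (\<xi> i) ((\<lambda>(g, j). \<nu> g (\<xi> j)) q) \<noteq> 0}" for i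
  define M where "M = (\<Sum>i\<in>{1..d}. \<Sum>q\<in>S i. \<phi> i q)"
  have S: "finite (S i)" if "i \<in> {1..d}" for i
    unfolding S_def using that by (intro finite_orbit_support fin)
  have \<phi>0: "\<phi> i q \<ge> 0" for i q by (simp add: \<phi>_def)
  have M0: "M \<ge> 0" by (simp add: M_def sum_nonneg \<phi>0)
  have rows: "(\<Sum>q\<in>F. cmod (cinner ((\<lambda>(g, i). \<nu> g (\<xi> i)) p) ((\<lambda>(g, i). \<nu> g (\<xi> i)) q))) \<le> M + 1"
    if F: "finite F" "F \<subseteq> carrier G \<times> {1..d}" and p: "p \<in> carrier G \<times> {1..d}" for F p
  proof -
    obtain g i where gi: "p = (g, i)" "g \<in> carrier G" "i \<in> {1..d}" using p by auto
    define t where "t = (\<lambda>(h :: 'g, j :: nat). (inv g \<otimes> h, j))"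
    have inj: "inj_on t F"
      using F(2) gi(2) by (auto simp: t_def inj_on_def subset_iff)
    have tF: "t ` F \<subseteq> carrier G \<times> {1..d}" using F(2) gi(2) by (auto simp: t_def)
    have "(\<Sum>q\<in>F. cmod (cinner ((\<lambda>(g, i). \<nu> g (\<xi> i)) p) ((\<lambda>(g, i). \<nu> g (\<xi> i)) q))) =
        (\<Sum>q\<in>F. \<phi> i (t q))"
      using F(2) gi by (intro sum.cong) (auto simp: \<phi>_def t_def cinner_translates)
    also have "\<dots> = sum (\<phi> i) (t ` F)"
      using inj by (simp add: sum.reindex)
    also have "\<dots> = sum (\<phi> i) (t ` F \<inter> S i)"
      using F(1) tF by (intro sum.mono_neutral_right) (auto simp: \<phi>_def S_def)
    also have "\<dots> \<le> sum (\<phi> i) (S i)"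
      using S[OF gi(3)] by (intro sum_mono2) (auto simp: \<phi>0)
    also have "\<dots> \<le> M"
      unfolding M_def using gi(3) by (intro member_le_sum) (auto intro: sum_nonneg \<phi>0)
    finally show ?thesis by simp
  qed
  show thesis
    by (rule that[of "M + 1"]) (use M0 rows in \<open>auto intro: synthesis_bound_of_Gram_rows\<close>)
qed

lemma algebra_form_coeff:
  assumes "finite {g \<in> carrier G. cinner \<zeta> (\<nu> g \<eta>) \<noteq> 0}" "k \<in> carrier G"
  shows "algebra_form G \<nu> \<zeta> \<eta> (l2_delta \<one>) k = cinner \<zeta> (\<nu> k \<eta>)"
  using assms by (auto simp: algebra_form_def lambda_sum_coeff)

lemma algebra_form_in:
  assumes "finite {g \<in> carrier G. cinner \<zeta> (\<nu> g \<eta>) \<noteq> 0}"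
  shows "algebra_form G \<nu> \<zeta> \<eta> \<in> group_algebra G"
  unfolding algebra_form_def using assms by (intro lambda_sum_in) auto

text \<open>Composition of operators is convolution of coefficients; unitarity turns
  \<open>cinner \<xi>' (\<nu> (inv g \<otimes> k) \<eta>)\<close>, the second factor, into the inner product of two translates.\<close>

lemma algebra_form_comp_coeff:
  assumes fin: "finite {g \<in> carrier G. cinner \<zeta> (\<nu> g \<xi>) \<noteq> 0}"
      "finite {g \<in> carrier G. cinner \<xi>' (\<nu> g \<eta>) \<noteq> 0}"
    and k: "k \<in> carrier G"
  shows "(algebra_form G \<nu> \<zeta> \<xi> \<circ> algebra_form G \<nu> \<xi>' \<eta>) (l2_delta \<one>) k =
    (\<Sum>g | g \<in> carrier G \<and> cinner \<zeta> (\<nu> g \<xi>) \<noteq> 0. cinner \<zeta> (\<nu> g \<xi>) * cinner (\<nu> g \<xi>') (\<nu> k \<eta>))"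
proof -
  have "algebra_form G \<nu> \<xi>' \<eta> (l2_delta \<one>) \<in> l2 G"
    unfolding algebra_form_def using fin by (intro lambda_sum_in_l2) auto
  then have "(algebra_form G \<nu> \<zeta> \<xi> \<circ> algebra_form G \<nu> \<xi>' \<eta>) (l2_delta \<one>) k =
      (\<Sum>g | g \<in> carrier G \<and> cinner \<zeta> (\<nu> g \<xi>) \<noteq> 0.
         cinner \<zeta> (\<nu> g \<xi>) * algebra_form G \<nu> \<xi>' \<eta> (l2_delta \<one>) (inv g \<otimes> k))"
    using k unfolding algebra_form_def[of G \<nu> \<zeta> \<xi>] o_def by (subst lambda_sum_apply) auto
  also have "\<dots> = (\<Sum>g | g \<in> carrier G \<and> cinner \<zeta> (\<nu> g \<xi>) \<noteq> 0.
      cinner \<zeta> (\<nu> g \<xi>) * cinner (\<nu> g \<xi>') (\<nu> k \<eta>))"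
    using fin k by (intro sum.cong) (auto simp: algebra_form_coeff cinner_translates)
  finally show ?thesis .
qed

lemma module_expansion_coeff_has_sum:
  fixes \<xi> \<xi>' :: "nat \<Rightarrow> 'h"
  assumes fin: "\<And>i. i \<in> {1..d} \<Longrightarrow> finite {g \<in> carrier G. cinner \<zeta> (\<nu> g (\<xi> i)) \<noteq> 0}"
      "\<And>i. i \<in> {1..d} \<Longrightarrow> finite {g \<in> carrier G. cinner (\<xi>' i) (\<nu> g \<eta>) \<noteq> 0}"
    and k: "k \<in> carrier G"
  shows "((\<lambda>(g, i). cinner \<zeta> (\<nu> g (\<xi> i)) * cinner (\<nu> g (\<xi>' i)) (\<nu> k \<eta>)) has_sum
      (\<Sum>i\<in>{1..d}. (algebra_form G \<nu> \<zeta> (\<xi> i) \<circ> algebra_form G \<nu> (\<xi>' i) \<eta>) (l2_delta \<one>) k))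
    (carrier G \<times> {1..d})"
proof -
  define t where "t g i = cinner \<zeta> (\<nu> g (\<xi> i)) * cinner (\<nu> g (\<xi>' i)) (\<nu> k \<eta>)" for g i
  \<comment> \<open>A common support for all \<open>i\<close>, to make the double sum a sum over a rectangle.\<close>
  define A where "A = (\<Union>i\<in>{1..d}. {g \<in> carrier G. cinner \<zeta> (\<nu> g (\<xi> i)) \<noteq> 0})"
  have A: "finite A" "A \<subseteq> carrier G" using fin(1) by (auto simp: A_def)
  have "(\<Sum>i\<in>{1..d}. (algebra_form G \<nu> \<zeta> (\<xi> i) \<circ> algebra_form G \<nu> (\<xi>' i) \<eta>) (l2_delta \<one>) k) =
      (\<Sum>i\<in>{1..d}. \<Sum>g | g \<in> carrier G \<and> cinner \<zeta> (\<nu> g (\<xi> i)) \<noteq> 0. t g i)"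
    unfolding t_def using fin k by (intro sum.cong refl algebra_form_comp_coeff)
  also have "\<dots> = (\<Sum>i\<in>{1..d}. \<Sum>g\<in>A. t g i)"
    using A(1) by (intro sum.cong refl sum.mono_neutral_left) (auto simp: A_def t_def)
  also have "\<dots> = (\<Sum>g\<in>A. \<Sum>i\<in>{1..d}. t g i)" by (rule sum.swap)
  also have "\<dots> = (\<Sum>(g, i)\<in>A \<times> {1..d}. t g i)" by (rule sum.cartesian_product)
  finally have "(\<Sum>i\<in>{1..d}. (algebra_form G \<nu> \<zeta> (\<xi> i) \<circ> algebra_form G \<nu> (\<xi>' i) \<eta>)
      (l2_delta \<one>) k) = (\<Sum>(g, i)\<in>A \<times> {1..d}. t g i)" .
  moreover have "((\<lambda>(g, i). t g i) has_sum (\<Sum>(g, i)\<in>A \<times> {1..d}. t g i)) (carrier G \<times> {1..d})"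
    using A by (intro has_sum_finite_support) (auto simp: A_def t_def)
  ultimately show ?thesis by (simp add: t_def)
qed

theorem dual_module_frames_iff_weak_duality:
  fixes \<xi> \<xi>' :: "nat \<Rightarrow> 'h"
  assumes E: "invariant_subspace G \<nu> E"
    and fin: "\<And>\<zeta> \<eta>. \<zeta> \<in> E \<Longrightarrow> \<eta> \<in> E \<Longrightarrow> finite {g \<in> carrier G. cinner \<zeta> (\<nu> g \<eta>) \<noteq> 0}"
    and \<xi>: "\<And>i. i \<in> {1..d} \<Longrightarrow> \<xi> i \<in> E" and \<xi>': "\<And>i. i \<in> {1..d} \<Longrightarrow> \<xi>' i \<in> E"
  shows "dual_module_frames G \<nu> E d \<xi> \<xi>' \<longleftrightarrow>
    weak_duality E (carrier G \<times> {1..d}) (\<lambda>(g, i). \<nu> g (\<xi> i)) (\<lambda>(g, i). \<nu> g (\<xi>' i))"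
proof -
  define R where "R \<zeta> \<eta> =
    (\<lambda>x h. \<Sum>i\<in>{1..d}. (algebra_form G \<nu> \<zeta> (\<xi> i) \<circ> algebra_form G \<nu> (\<xi>' i) \<eta>) x h)" for \<zeta> \<eta>
  define W where "W \<zeta> \<eta> \<longleftrightarrow>
    ((\<lambda>(g, i). cinner \<zeta> (\<nu> g (\<xi> i)) * cinner (\<nu> g (\<xi>' i)) \<eta>) has_sum cinner \<zeta> \<eta>)
      (carrier G \<times> {1..d})" for \<zeta> \<eta>
  have R_coeff: "W \<zeta> (\<nu> k \<eta>) \<longleftrightarrow>
      algebra_form G \<nu> \<zeta> \<eta> (l2_delta \<one>) k = R \<zeta> \<eta> (l2_delta \<one>) k"
    if "\<zeta> \<in> E" "\<eta> \<in> E" "k \<in> carrier G" for \<zeta> \<eta> k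
  proof -
    have "((\<lambda>(g, i). cinner \<zeta> (\<nu> g (\<xi> i)) * cinner (\<nu> g (\<xi>' i)) (\<nu> k \<eta>)) has_sum
        R \<zeta> \<eta> (l2_delta \<one>) k) (carrier G \<times> {1..d})"
      unfolding R_def using that \<xi> \<xi>' by (intro module_expansion_coeff_has_sum fin)
    then show ?thesis
      using that by (auto simp: W_def algebra_form_coeff fin dest: has_sum_unique)
  qed
  have "algebra_form G \<nu> \<zeta> \<eta> = R \<zeta> \<eta> \<longleftrightarrow> (\<forall>k\<in>carrier G. W \<zeta> (\<nu> k \<eta>))"
    if "\<zeta> \<in> E" "\<eta> \<in> E" for \<zeta> \<eta>
  proof -
    have "R \<zeta> \<eta> \<in> group_algebra G"
      unfolding R_def using that \<xi> \<xi>'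
      by (intro group_algebra_sum group_algebra_comp algebra_form_in fin) auto
    then show ?thesis
      using that R_coeff group_algebra_eqI[OF algebra_form_in[OF fin]] by metis
  qed
  then have "dual_module_frames G \<nu> E d \<xi> \<xi>' \<longleftrightarrow>
      (\<forall>\<zeta>\<in>E. \<forall>\<eta>\<in>E. \<forall>k\<in>carrier G. W \<zeta> (\<nu> k \<eta>))"
    by (simp add: dual_module_frames_def R_def)
  also have "\<dots> \<longleftrightarrow> (\<forall>\<zeta>\<in>E. \<forall>\<eta>\<in>E. W \<zeta> \<eta>)"
    using invariant_subspace_rep[OF E] by (metis one_closed rep_one)
  finally show ?thesis
    by (simp add: weak_duality_def W_def case_prod_unfold)
qed

end

theorem theorem3p4:
  fixes G :: "('g, 'm) monoid_scheme"
    and \<nu> :: "'g \<Rightarrow> 'h::complex_hilbert_space \<Rightarrow> 'h"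
    and \<Lambda> E :: "'h set"
    and d :: nat
    and \<xi> \<xi>' :: "nat \<Rightarrow> 'h"
  assumes "group G" and "countable (carrier G)"
    and "\<nu> \<in> hom G unitary_group"
    and "invariant_subspace G \<nu> \<Lambda>"
    and "\<And>\<zeta> \<eta>. \<zeta> \<in> \<Lambda> \<Longrightarrow> \<eta> \<in> \<Lambda> \<Longrightarrow> finite {g \<in> carrier G. cinner \<zeta> (\<nu> g \<eta>) \<noteq> 0}"
    and "E \<subseteq> \<Lambda>" and "invariant_subspace G \<nu> E"
    and "\<And>i. i \<in> {1..d} \<Longrightarrow> \<xi> i \<in> E" and "\<And>i. i \<in> {1..d} \<Longrightarrow> \<xi>' i \<in> E"
  shows "dual_G_frames G \<nu> (closure E) d \<xi> \<xi>' \<longleftrightarrow> dual_module_frames G \<nu> E d \<xi> \<xi>'"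
proof -
  interpret unitary_representation G \<nu>
    using assms(1,3) by (simp add: unitary_representation_def unitary_representation_axioms_def)
  have fin: "finite {g \<in> carrier G. cinner \<zeta> (\<nu> g \<eta>) \<noteq> 0}" if "\<zeta> \<in> E" "\<eta> \<in> E" for \<zeta> \<eta>
    using that assms(5,6) by blast
  obtain B where B: "B > 0" "synthesis_bound (carrier G \<times> {1..d}) (\<lambda>(g, i). \<nu> g (\<xi> i)) B"
    by (rule orbit_synthesis_bound[of d \<xi>, OF fin[OF assms(8) assms(8)]])
  obtain B' where B': "B' > 0" "synthesis_bound (carrier G \<times> {1..d}) (\<lambda>(g, i). \<nu> g (\<xi>' i)) B'"
    by (rule orbit_synthesis_bound[of d \<xi>', OF fin[OF assms(9) assms(9)]])
  have "dual_frames (closure E) (carrier G \<times> {1..d}) (\<lambda>(g, i). \<nu> g (\<xi> i)) (\<lambda>(g, i). \<nu> g (\<xi>' i))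
      \<longleftrightarrow> weak_duality E (carrier G \<times> {1..d}) (\<lambda>(g, i). \<nu> g (\<xi> i)) (\<lambda>(g, i). \<nu> g (\<xi>' i))"
  proof (rule dual_frames_iff_weak_duality[OF _ _ _ _ B(2,1) B'(2,1)])
    show "countable (carrier G \<times> {1..d})" using assms(2) by auto
    show "complex_vector.subspace E" using assms(7) by (simp add: invariant_subspace_def)
    show "(\<lambda>(g, i). \<nu> g (\<xi> i)) p \<in> E" if "p \<in> carrier G \<times> {1..d}" for p
      using that assms(8) invariant_subspace_rep[OF assms(7)] by auto
    show "(\<lambda>(g, i). \<nu> g (\<xi>' i)) p \<in> E" if "p \<in> carrier G \<times> {1..d}" for p
      using that assms(9) invariant_subspace_rep[OF assms(7)] by auto
    show "finite {p \<in> carrier G \<times> {1..d}. cinner \<zeta> ((\<lambda>(g, i). \<nu> g (\<xi> i)) p) \<noteq> 0}"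
      if "\<zeta> \<in> E" for \<zeta> using that assms(8) by (intro finite_orbit_support fin)
    show "finite {p \<in> carrier G \<times> {1..d}. cinner \<zeta> ((\<lambda>(g, i). \<nu> g (\<xi>' i)) p) \<noteq> 0}"
      if "\<zeta> \<in> E" for \<zeta> using that assms(9) by (intro finite_orbit_support fin)
  qed
  then show ?thesis
    using dual_module_frames_iff_weak_duality[OF assms(7) fin assms(8,9)]
    by (simp add: dual_G_frames_def)
qed

end
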